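(* For each fixed integer $r\ge 2$ there exists a constant $\gamma>0$ such that with high probability (as $n\to\infty$): (i) there exists an $r$-coloring of the edges of $\mathcal{G}_{n,r\text{-out}}$ such that the largest monochromatic component has order $o(n)$; (ii) every $r$-coloring of the edges of $\mathcal{G}_{n,(r+1)\text{-out}}$ contains a monochromatic cycle of length at least $\gamma n$.
   Context: For $1\le k\le n-1$, $\mathcal{D}_{n,k\text{-out}}$ is the random digraph on vertex set $[n]=\{1,\dots,n\}$ in which each vertex independently chooses a set of $k$ out-neighbors uniformly at random from all $\binom{n-1}{k}$ choices (of $k$-subsets of the other vertices). $\mathcal{G}_{n,k\text{-out}}$ is the random (multi)graph obtained from $\mathcal{D}_{n,k\text{-out}}$ by ignoring the orientation of the arcs (so if both $(u,v)$ and $(v,u)$ are arcs, then $u$ and $v$ are joined by two parallel edges). "With high probability" (w.h.p.) means with probability tending to $1$ as $n\to\infty$, with $r$ fixed. An $r$-coloring of the edges is an arbitrary (not necessarily proper) map from the edge (multi)set to $[r]=\{1,\dots,r\}$. A monochromatic component is a connected component of the subgraph formed by all the edges of one color; its order is its number of vertices. A monochromatic cycle is a cycle all of whose edges have the same color. In (i), "order $o(n)$ w.h.p." means: there is a function $f$ (depending only on $r$) with $f(n)/n\to 0$ such that w.h.p. there is an $r$-coloring in which every monochromatic component has at most $f(n)$ vertices. *)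

theory Defs
  imports "HOL-Probability.Probability" "Graph_Theory.Pair_Digraph"
begin

text \<open>Undirected multigraphs. Edges are abstract objects, so parallel edges are distinct edges
  with the same set of ends (a loop at v would have the set of ends {v}).\<close>

record ('v, 'e) multigraph =
  mverts :: "'v set"
  medges :: "'e set"
  mends :: "'e \<Rightarrow> 'v set"

text \<open>The edges are the arcs themselves, so opposite arcs (u,v) and (v,u) give two parallel edges.\<close>

definition forget_orientation :: "'v pair_pre_digraph \<Rightarrow> ('v, 'v \<times> 'v) multigraph" where
  "forget_orientation D =
     \<lparr>mverts = pverts D, medges = parcs D, mends = (\<lambda>(u, v). {u, v})\<rparr>"

definition connectivity :: "('v, 'e) multigraph \<Rightarrow> ('v \<times> 'v) set" where
  "connectivity G =
     {(u, v). u \<in> mverts G \<and> v \<in> mverts G \<and>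
        (u, v) \<in> {(x, y). \<exists>e\<in>medges G. mends G e = {x, y}}\<^sup>*}"

definition component_verts :: "('v, 'e) multigraph \<Rightarrow> 'v set set" where
  "component_verts G = mverts G // connectivity G"

text \<open>A cycle with vertices \<open>vs\<close> and edges \<open>es\<close>, where the i-th edge joins the i-th vertex to its
  cyclic successor; its length is the length of \<open>es\<close>. Two distinct parallel edges form a cycle of
  length 2, whereas traversing the same edge back and forth does not.\<close>

definition is_cycle :: "('v, 'e) multigraph \<Rightarrow> 'v list \<Rightarrow> 'e list \<Rightarrow> bool" where
  "is_cycle G vs es \<longleftrightarrow>
     es \<noteq> [] \<and> length vs = length es \<and> distinct vs \<and> distinct es \<and>
     set vs \<subseteq> mverts G \<and> set es \<subseteq> medges G \<and>
     (\<forall>i<length es. mends G (es ! i) = {vs ! i, vs ! (Suc i mod length es)})"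

definition edge_coloring :: "nat \<Rightarrow> ('v, 'e) multigraph \<Rightarrow> ('e \<Rightarrow> nat) \<Rightarrow> bool" where
  "edge_coloring r G c \<longleftrightarrow> c \<in> medges G \<rightarrow> {1..r}"

text \<open>The subgraph formed by the edges of color \<open>i\<close> has the ends of these edges as its vertices.\<close>

definition color_subgraph ::
  "('v, 'e) multigraph \<Rightarrow> ('e \<Rightarrow> nat) \<Rightarrow> nat \<Rightarrow> ('v, 'e) multigraph" where
  "color_subgraph G c i =
     (let E = {e \<in> medges G. c e = i}
      in \<lparr>mverts = \<Union> (mends G ` E), medges = E, mends = mends G\<rparr>)"

definition mono_component_verts ::
  "nat \<Rightarrow> ('v, 'e) multigraph \<Rightarrow> ('e \<Rightarrow> nat) \<Rightarrow> 'v set set" where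
  "mono_component_verts r G c = (\<Union>i\<in>{1..r}. component_verts (color_subgraph G c i))"

definition mono_cycle ::
  "nat \<Rightarrow> ('v, 'e) multigraph \<Rightarrow> ('e \<Rightarrow> nat) \<Rightarrow> 'v list \<Rightarrow> 'e list \<Rightarrow> bool" where
  "mono_cycle r G c vs es \<longleftrightarrow> (\<exists>i\<in>{1..r}. is_cycle (color_subgraph G c i) vs es)"

text \<open>\<open>N u\<close> is the random set of out-neighbors of \<open>u\<close>; these sets are independent. The model is
  meaningful only for \<open>1 \<le> k\<close> and \<open>k \<le> n - 1\<close>; for \<open>k \<ge> n\<close> (with \<open>n > 0\<close>) there is no
  admissible set and the value is unspecified.\<close>

definition k_out_digraph :: "nat \<Rightarrow> nat \<Rightarrow> nat pair_pre_digraph pmf" where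
  "k_out_digraph n k =
     map_pmf (\<lambda>N. \<lparr>pverts = {1..n}, parcs = (SIGMA u:{1..n}. N u)\<rparr>)
       (Pi_pmf {1..n} {} (\<lambda>u. pmf_of_set {S. S \<subseteq> {1..n} - {u} \<and> card S = k}))"

definition k_out_graph :: "nat \<Rightarrow> nat \<Rightarrow> (nat, nat \<times> nat) multigraph pmf" where
  "k_out_graph n k = map_pmf forget_orientation (k_out_digraph n k)"

definition whp :: "(nat \<Rightarrow> 'a pmf) \<Rightarrow> (nat \<Rightarrow> 'a \<Rightarrow> bool) \<Rightarrow> bool" where
  "whp M P \<longleftrightarrow> (\<lambda>n. measure_pmf.prob (M n) {x. P n x}) \<longlonglongrightarrow> 1"

end

theory Submission
  imports Defs "HOL-Real_Asymp.Real_Asymp"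
begin

text \<open>(ii) Some colour has at least \<open>(1 + 1/r) n\<close> arcs, whereas with high probability every set of at
  most \<open>\<sigma> n\<close> vertices spans at most \<open>1 + 1/(2r)\<close> times as many arcs as vertices. A minimal vertex set
  of density at least \<open>1 + 1/r\<close> in that colour is therefore large, and its subsets of size about
  \<open>c n\<close> have linearly many neighbours; depth-first exploration then finds a linear cycle.

  (i) Order the out-neighbours of each vertex at random, which gives \<open>r\<close> random functional digraphs
  \<open>F\<^sub>0, \<dots>, F\<^sub>r\<^sub>-\<^sub>1\<close>. Cut \<open>F\<^sub>0\<close>, at few arcs, into blocks of order between \<open>s = n\<^sup>0\<^sup>.\<^sup>9\<close> and \<open>o(n)\<close>, and
  colour all arcs inside blocks with 1. An arc of \<open>F\<^sub>j\<close> with \<open>j \<ge> 1\<close> lies inside a block with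
  probability about \<open>s/n\<close>, so a path of \<open>F\<^sub>j\<close> that only uses crossing arcs has typical length at most \<open>n/s\<close>
  and two such paths rarely meet. Hence each crossing \<open>F\<^sub>j\<close> has small components, and the few crossing
  arcs of \<open>F\<^sub>0\<close> can be added to one of them.\<close>

section \<open>Long cycles in expanding graphs\<close>

text \<open>The obstacle in (i) is dependence. The blocks are read off from
  \<open>F\<^sub>0\<close>, and the out-neighbours of a vertex are distinct, so
  \<open>F\<^sub>j\<close> is not independent of \<open>F\<^sub>0\<close>. Instead of conditioning,
  the labelling is made a function of \<open>F\<^sub>0\<close> alone and a union is taken over all
  possible maps \<open>g\<close> in its place. Each \<open>g\<close> has weight at most
  \<open>(1 / (n - 1))^n\<close>, every prescribed arc of index j costs a further factor at most
  \<open>1 / (n - 2)\<close>, and as there are at most \<open>(n - 1)^n\<close> maps, the weights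
  sum to at most 1. The blocks are bounded below to make crossing paths short and above to keep
  colour 1 small. The upper bound needs a bound on the in-degrees: below a vertex with many
  in-neighbours, a tree may split only into tiny pieces or one huge piece. In (ii) the threshold 1 +
  1/(2r) lies strictly between 1 and 1 + 1/r. Below 1 + 1/r, it contradicts the density of a small
  dense set with room to spare for expansion. Above 1, a set of s vertices spans a > s arcs, and the
  factor \<open>n^(s - a)\<close> makes the first moment vanish.\<close>

definition induced_rel :: "('a \<Rightarrow> 'a \<Rightarrow> bool) \<Rightarrow> 'a set \<Rightarrow> ('a \<times> 'a) set" where
  "induced_rel E A = {(x, y). x \<in> A \<and> y \<in> A \<and> E x y}"

definition nbhd :: "('a \<Rightarrow> 'a \<Rightarrow> bool) \<Rightarrow> 'a set \<Rightarrow> 'a set" where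
  "nbhd E W = {y. y \<notin> W \<and> (\<exists>x\<in>W. E x y)}"

text \<open>Cut a walk from \<open>b\<close> to \<open>a\<close> after its last visit to
  \<open>b\<close>. Hence deleting \<open>b\<close> leaves every reachable vertex attached to some
  neighbour of \<open>b\<close>, which is the invariant of the exploration below.\<close>

lemma induced_rtrancl_leave:
  assumes "(b, a) \<in> (induced_rel E A)\<^sup>*" and "a \<noteq> b"
  shows "\<exists>c\<in>A - {b}. E b c \<and> (c, a) \<in> (induced_rel E (A - {b}))\<^sup>*"
  using assms
proof (induction rule: rtrancl_induct)
  case base
  then show ?case by simp
next
  case (step y z)
  show ?case
  proof (cases "y = b")
    case True
    then show ?thesis using step by (auto simp: induced_rel_def)
  next
    case False
    then obtain c where c: "c \<in> A - {b}" "E b c" "(c, y) \<in> (induced_rel E (A - {b}))\<^sup>*"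
      using step by blast
    have "(y, z) \<in> induced_rel E (A - {b})"
      using step False by (auto simp: induced_rel_def)
    then show ?thesis using c by (meson rtrancl.rtrancl_into_rtrancl)
  qed
qed

lemma induced_rtrancl_path:
  assumes "(b, w) \<in> (induced_rel E A)\<^sup>*" and "b \<in> A"
  shows "\<exists>q. q \<noteq> [] \<and> hd q = b \<and> last q = w \<and> distinct q \<and> set q \<subseteq> A \<and> successively E q"
  using assms
proof (induction rule: rtrancl_induct)
  case base
  then show ?case by (intro exI[of _ "[b]"]) auto
next
  case (step y z)
  then obtain q where q: "q \<noteq> []" "hd q = b" "last q = y" "distinct q" "set q \<subseteq> A" "successively E q"
    by blast
  have yz: "z \<in> A" "E y z" using step by (auto simp: induced_rel_def)
  show ?case
  proof (cases "z \<in> set q")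
    case True
    then obtain q1 q2 where e: "q = q1 @ z # q2" by (meson split_list)
    have "hd (q1 @ [z]) = b" using q(2) e by (cases q1) auto
    then show ?thesis using q(4-6) e
      by (intro exI[of _ "q1 @ [z]"]) (auto simp: successively_append_iff)
  next
    case False
    then show ?thesis using q yz
      by (intro exI[of _ "q @ [z]"]) (auto simp: successively_append_iff)
  qed
qed

text \<open>For symmetric \<open>E\<close> these are the unions of components of the graph induced
  on \<open>A\<close>; all neighbours of such a set lie outside \<open>A\<close>.\<close>

definition induced_closed :: "('a \<Rightarrow> 'a \<Rightarrow> bool) \<Rightarrow> 'a set \<Rightarrow> 'a set \<Rightarrow> bool" where
  "induced_closed E A W \<longleftrightarrow> W \<subseteq> A \<and> (\<forall>x\<in>W. \<forall>y\<in>A. E x y \<longrightarrow> y \<in> W)"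

lemma induced_closed_component:
  "x \<in> A \<Longrightarrow> induced_closed E A ((induced_rel E A)\<^sup>* `` {x})"
  unfolding induced_closed_def
proof (intro conjI ballI impI subsetI)
  fix y assume "x \<in> A" "y \<in> (induced_rel E A)\<^sup>* `` {x}"
  then have "(x, y) \<in> (induced_rel E A)\<^sup>*" by simp
  then show "y \<in> A" using \<open>x \<in> A\<close> by (induction rule: rtrancl_induct) (auto simp: induced_rel_def)
  fix z assume "z \<in> A" "E y z"
  with \<open>y \<in> A\<close> have "(y, z) \<in> induced_rel E A" by (simp add: induced_rel_def)
  with \<open>(x, y) \<in> (induced_rel E A)\<^sup>*\<close> show "z \<in> (induced_rel E A)\<^sup>* `` {x}"
    by (meson ImageI insertI1 rtrancl.rtrancl_into_rtrancl)
qed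

lemma induced_closed_Un:
  "induced_closed E A W \<Longrightarrow> induced_closed E A W' \<Longrightarrow> induced_closed E A (W \<union> W')"
  unfolding induced_closed_def by blast

text \<open>Take a largest union of components with at most \<open>k\<close> vertices. If it has
  fewer than k/2, then any further component makes it exceed \<open>k\<close>, so that component
  alone has more than k/2 vertices.\<close>

lemma induced_closed_medium:
  assumes fin: "finite A" and k: "k \<le> card A" "1 \<le> k"
    and small: "\<And>x. x \<in> A \<Longrightarrow> card ((induced_rel E A)\<^sup>* `` {x}) \<le> k"
  shows "\<exists>W. induced_closed E A W \<and> k \<le> 2 * card W \<and> card W \<le> k"
proof -
  let ?P = "\<lambda>W. induced_closed E A W \<and> card W \<le> k"
  have "?P {}" by (simp add: induced_closed_def)
  then have "\<exists>W. ?P W \<and> (\<forall>V. ?P V \<longrightarrow> card V \<le> card W)"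
    by (rule ex_has_greatest_nat[where b = "Suc k"]) auto
  then obtain W where W: "?P W" and max: "\<And>V. ?P V \<Longrightarrow> card V \<le> card W"
    by auto
  have WA: "W \<subseteq> A" using W by (simp add: induced_closed_def)
  show ?thesis
  proof (cases "k \<le> 2 * card W")
    case True
    then show ?thesis using W by blast
  next
    case False
    then have "card W < card A" using k by linarith
    then obtain x where x: "x \<in> A" "x \<notin> W"
      using WA by (metis subsetI subset_antisym less_irrefl)
    let ?C = "(induced_rel E A)\<^sup>* `` {x}"
    have cl: "induced_closed E A ?C" using x by (intro induced_closed_component)
    then have fC: "finite ?C" "finite W"
      using fin WA by (auto simp: induced_closed_def intro: finite_subset)
    have "card W < card (W \<union> ?C)"
      using x fC by (intro psubset_card_mono) auto
    then have "\<not> ?P (W \<union> ?C)" using max by (meson not_le)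
    then have "k < card (W \<union> ?C)"
      using W cl induced_closed_Un by (meson not_le)
    also have "\<dots> \<le> card W + card ?C" by (rule card_Un_le)
    finally show ?thesis using False small[OF x(1)] cl
      by (intro exI[of _ ?C]) auto
  qed
qed

text \<open>A path whose last vertex sees every component of the unexplored set \<open>A\<close> either grows into a
  large component or, if all components are small, closes up through a union \<open>W\<close> of components:
  the at least \<open>t\<close> neighbours of \<open>W\<close> all lie on the path, so one of them is far from its end.\<close>

lemma long_cycle_aux:
  assumes sym: "\<And>x y. E x y \<Longrightarrow> E y x"
    and t: "1 \<le> t" and k: "1 \<le> k"
    and expand: "\<And>W. W \<subseteq> U \<Longrightarrow> k \<le> 2 * card W \<Longrightarrow> card W \<le> k \<Longrightarrow> t \<le> card (nbhd E W)"
    and "finite A" "A \<subseteq> U" "k \<le> card A"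
    and "p \<noteq> []" "distinct p" "successively E p" "A \<inter> set p = {}"
    and "\<And>a. a \<in> A \<Longrightarrow> \<exists>b\<in>A. E (last p) b \<and> (b, a) \<in> (induced_rel E A)\<^sup>*"
    and "nbhd E A \<subseteq> set p"
  shows "\<exists>q. distinct q \<and> t < length q \<and> successively E q \<and> E (last q) (hd q)"
  using assms(5-)
proof (induction "card A" arbitrary: A p rule: less_induct)
  case less
  note fin = \<open>finite A\<close> and AU = \<open>A \<subseteq> U\<close> and kA = \<open>k \<le> card A\<close> and p = \<open>p \<noteq> []\<close> \<open>distinct p\<close>
    \<open>successively E p\<close> and dis = \<open>A \<inter> set p = {}\<close> and att = less.prems(8)
    and nb = \<open>nbhd E A \<subseteq> set p\<close>
  show ?case
  proof (cases "\<exists>x\<in>A. k < card ((induced_rel E A)\<^sup>* `` {x})")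
    case True
    then obtain x where x: "x \<in> A" "k < card ((induced_rel E A)\<^sup>* `` {x})" by blast
    let ?R = "induced_rel E A"
    obtain b where b: "b \<in> A" "E (last p) b" "(b, x) \<in> ?R\<^sup>*" using att x by blast
    have "sym ?R" by (auto simp: sym_def induced_rel_def intro: sym)
    then have "sym (?R\<^sup>*)" by (rule sym_rtrancl)
    then have "(x, b) \<in> ?R\<^sup>*" using b by (meson symD)
    let ?C = "?R\<^sup>* `` {b}"
    have "?R\<^sup>* `` {x} \<subseteq> ?C" using b(3) by (auto intro: rtrancl_trans)
    have clC: "induced_closed E A ?C" by (rule induced_closed_component[OF b(1)])
    then have CA: "?C \<subseteq> A" by (simp add: induced_closed_def)
    have fC: "finite ?C" using CA fin finite_subset by blast
    have kC: "k < card ?C" using x(2) \<open>?R\<^sup>* `` {x} \<subseteq> ?C\<close> fC card_mono by (meson less_le_trans)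
    have bC: "b \<in> ?C" by simp
    \<comment> \<open>The path is extended by \<open>b\<close> and only the rest of its component is
      kept; the other components are abandoned. As \<open>?C\<close> is a whole component of
      \<open>A\<close>, neighbours of \<open>?A\<close> are \<open>b\<close> or old path vertices. A
      component with more than \<open>k\<close> vertices still has \<open>k\<close> left.\<close>
    let ?A = "?C - {b}"
    have cA: "card ?A = card ?C - 1" using bC fC by simp
    have "card ?A < card A"
      using psubset_card_mono[OF fin, of ?A] CA b(1) by blast
    moreover have "\<exists>c\<in>?A. E (last (p @ [b])) c \<and> (c, a) \<in> (induced_rel E ?A)\<^sup>*" if a: "a \<in> ?A" for a
    proof -
      have "(b, a) \<in> ?R\<^sup>*" using a by simp
      then have "(b, a) \<in> (induced_rel E ?C)\<^sup>*"
      proof (induction rule: rtrancl_induct)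
        case base
        then show ?case by simp
      next
        case (step y z)
        then have "(y, z) \<in> induced_rel E ?C"
          unfolding induced_rel_def by (auto intro: rtrancl_into_rtrancl simp: induced_rel_def)
        then show ?case using step by (meson rtrancl.rtrancl_into_rtrancl)
      qed
      then show ?thesis using induced_rtrancl_leave[of b a E ?C] a by simp
    qed
    moreover have "nbhd E ?A \<subseteq> set (p @ [b])"
    proof
      fix y assume "y \<in> nbhd E ?A"
      then obtain a where a: "y \<notin> ?A" "a \<in> ?A" "E a y" by (auto simp: nbhd_def)
      show "y \<in> set (p @ [b])"
      proof (cases "y \<in> A")
        case True
        then have "y \<in> ?C" using a clC unfolding induced_closed_def by blast
        then show ?thesis using a by auto
      next
        case False
        then have "y \<in> nbhd E A" using a CA unfolding nbhd_def by blast
        then show ?thesis using nb by auto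
      qed
    qed
    moreover have "successively E (p @ [b])"
      using p b by (simp add: successively_append_iff)
    moreover have "distinct (p @ [b])" "?A \<inter> set (p @ [b]) = {}" using p dis b CA by auto
    moreover have "k \<le> card ?A" using kC cA by linarith
    moreover have "?A \<subseteq> U" "finite ?A" using CA AU fC by blast+
    ultimately show ?thesis by (intro less.hyps[of ?A "p @ [b]"]) auto
  next
    case False
    then have "\<And>x. x \<in> A \<Longrightarrow> card ((induced_rel E A)\<^sup>* `` {x}) \<le> k" by (meson not_le)
    from induced_closed_medium[OF fin kA k this]
    obtain W where W: "induced_closed E A W" "k \<le> 2 * card W" "card W \<le> k" by blast
    have WA: "W \<subseteq> A" using W by (simp add: induced_closed_def)
    have tN: "t \<le> card (nbhd E W)" using W WA AU by (intro expand) auto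
    have Np: "nbhd E W \<subseteq> set p"
    proof
      fix y assume "y \<in> nbhd E W"
      then obtain a where a: "y \<notin> W" "a \<in> W" "E a y" by (auto simp: nbhd_def)
      then have "y \<notin> A" using W unfolding induced_closed_def by blast
      then have "y \<in> nbhd E A" using a WA unfolding nbhd_def by blast
      then show "y \<in> set p" using nb by auto
    qed
    have "nbhd E W \<noteq> {}" using tN t by force
    then have "\<exists>x\<in>set p. x \<in> nbhd E W" using Np by blast
    \<comment> \<open>\<open>x\<close> is the earliest path vertex adjacent to \<open>W\<close>, so
      all the neighbours of \<open>W\<close> lie in \<open>x # p2\<close>. A path inside
      \<open>A\<close> from a neighbour of \<open>last p\<close> to \<open>W\<close> closes this
      segment to a cycle.\<close>
    then obtain p1 x p2 where px: "p = p1 @ x # p2" "x \<in> nbhd E W" "\<forall>y\<in>set p1. y \<notin> nbhd E W"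
      using split_list_first_prop[of p "\<lambda>x. x \<in> nbhd E W"] by blast
    have "nbhd E W \<subseteq> set (x # p2)" using Np px by auto
    then have "card (nbhd E W) \<le> card (set (x # p2))" by (intro card_mono) auto
    then have len: "t \<le> length (x # p2)" using tN card_length[of "x # p2"] by linarith
    obtain w where w: "w \<in> W" "E w x" using px(2) by (auto simp: nbhd_def)
    then have "w \<in> A" using WA by auto
    then obtain b where b: "b \<in> A" "E (last p) b" "(b, w) \<in> (induced_rel E A)\<^sup>*" using att by blast
    from induced_rtrancl_path[OF b(3,1)] obtain q where
      q: "q \<noteq> []" "hd q = b" "last q = w" "distinct q" "set q \<subseteq> A" "successively E q" by blast
    have lp: "last p = last (x # p2)" using px by simp
    have "successively E (x # p2)" "distinct (x # p2)" using p px by (auto simp: successively_append_iff)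
    then have "successively E ((x # p2) @ q)"
      unfolding successively_append_iff using q b(2) lp by simp
    moreover have "distinct ((x # p2) @ q)" using q p px dis by auto
    moreover have "t < length ((x # p2) @ q)" using len q(1) by (cases q) auto
    moreover have "E (last ((x # p2) @ q)) (hd ((x # p2) @ q))" using q w by simp
    ultimately show ?thesis by blast
  qed
qed

text \<open>Connectivity serves only to start the exploration at a single vertex \<open>v\<close>:
  every other vertex of \<open>U\<close> then hangs on a neighbour of \<open>v\<close>.\<close>

lemma long_cycle:
  assumes sym: "\<And>x y. E x y \<Longrightarrow> E y x"
    and t: "1 \<le> t" and k: "1 \<le> k" and kU: "k < card U"
    and U: "\<And>x y. E x y \<Longrightarrow> x \<in> U \<and> y \<in> U"
    and connected: "\<And>W. W \<subseteq> U \<Longrightarrow> W \<noteq> {} \<Longrightarrow> W \<noteq> U \<Longrightarrow> nbhd E W \<noteq> {}"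
    and expand: "\<And>W. W \<subseteq> U \<Longrightarrow> k \<le> 2 * card W \<Longrightarrow> card W \<le> k \<Longrightarrow> t \<le> card (nbhd E W)"
  shows "\<exists>q. distinct q \<and> t < length q \<and> successively E q \<and> E (last q) (hd q)"
proof -
  have fU: "finite U" using kU by (metis card.infinite not_less0)
  obtain v where v: "v \<in> U" using kU by fastforce
  let ?A = "U - {v}"
  let ?C = "(induced_rel E U)\<^sup>* `` {v}"
  have clC: "induced_closed E U ?C" by (rule induced_closed_component[OF v])
  have "?C = U"
  proof (rule ccontr)
    assume "?C \<noteq> U"
    moreover have "?C \<subseteq> U" using clC by (simp add: induced_closed_def)
    ultimately have "nbhd E ?C \<noteq> {}" using connected[of ?C] by blast
    then show False using clC U unfolding nbhd_def induced_closed_def by blast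
  qed
  have att: "\<exists>b\<in>?A. E (last [v]) b \<and> (b, a) \<in> (induced_rel E ?A)\<^sup>*" if "a \<in> ?A" for a
    using induced_rtrancl_leave[of v a E U] that \<open>?C = U\<close> by auto
  have "nbhd E ?A \<subseteq> set [v]" using U by (auto simp: nbhd_def)
  moreover have "k \<le> card ?A" using kU v fU by simp
  ultimately show ?thesis
    using long_cycle_aux[where A = ?A and p = "[v]" and U = U, OF sym t k expand] att fU by auto
qed

section \<open>Dense, locally sparse digraphs\<close>

definition arcs_in :: "('a \<times> 'a) set \<Rightarrow> 'a set \<Rightarrow> ('a \<times> 'a) set" where
  "arcs_in F S = {a \<in> F. fst a \<in> S \<and> snd a \<in> S}"

lemma finite_arcs_in: "finite F \<Longrightarrow> finite (arcs_in F S)"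
  by (simp add: arcs_in_def)

text \<open>A minimal vertex set \<open>U\<close> of density at least \<open>1 + 1/r\<close> is connected, and it expands because a
  small set \<open>W\<close> with few neighbours would span too many arcs together with them.\<close>

lemma dense_locally_sparse_long_cycle:
  fixes r t :: nat
  assumes fV: "finite V" and F: "F \<subseteq> V \<times> V" and "V \<noteq> {}" and r: "1 \<le> r" and t: "1 \<le> t"
    and dense: "(r + 1) * card V \<le> r * card F"
    and sparse: "\<And>S. S \<subseteq> V \<Longrightarrow> S \<noteq> {} \<Longrightarrow> card S \<le> (4 * r + 3) * t \<Longrightarrow>
      2 * r * card (arcs_in F S) \<le> (2 * r + 1) * card S"
  shows "\<exists>q. distinct q \<and> t < length q \<and> successively (\<lambda>x y. (x, y) \<in> F \<or> (y, x) \<in> F) q \<and>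
    ((last q, hd q) \<in> F \<or> (hd q, last q) \<in> F)"
proof -
  have fF: "finite F" using F fV finite_subset by blast
  let ?Q = "\<lambda>U. U \<subseteq> V \<and> U \<noteq> {} \<and> (r + 1) * card U \<le> r * card (arcs_in F U)"
  have "arcs_in F V = F" using F by (auto simp: arcs_in_def)
  then have "?Q V" using dense \<open>V \<noteq> {}\<close> by simp
  then obtain U where U: "?Q U" and min: "\<And>W. ?Q W \<Longrightarrow> card U \<le> card W"
    using ex_has_least_nat[of ?Q V card] by blast
  have fU: "finite U" using U fV finite_subset by blast
  have cU: "0 < card U" using U fU by (simp add: card_gt_0_iff)
  \<comment> \<open>A set within the range of \<open>sparse\<close> has density at most 1 + 1/(2r),
    below the density 1 + 1/r of \<open>U\<close>.\<close>
  have big: "(4 * r + 3) * t < card U"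
  proof (rule ccontr)
    assume "\<not> ?thesis"
    then have "2 * r * card (arcs_in F U) \<le> (2 * r + 1) * card U" using U by (intro sparse) auto
    moreover have "2 * ((r + 1) * card U) \<le> 2 * (r * card (arcs_in F U))" using U by simp
    ultimately have "2 * ((r + 1) * card U) \<le> (2 * r + 1) * card U" by (simp add: mult.assoc)
    then show False using cU by (simp add: algebra_simps)
  qed
  define E where "E = (\<lambda>x y. x \<in> U \<and> y \<in> U \<and> ((x, y) \<in> F \<or> (y, x) \<in> F))"
  have minW: "r * card (arcs_in F W) < (r + 1) * card W" if "W \<subseteq> U" "W \<noteq> {}" "W \<noteq> U" for W
  proof (rule ccontr)
    assume "\<not> ?thesis"
    then have "?Q W" using that U by auto
    then have "card U \<le> card W" by (rule min)
    moreover have "card W < card U" using that fU by (intro psubset_card_mono) auto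
    ultimately show False by simp
  qed
  \<comment> \<open>Arcs of \<open>U\<close> that meet \<open>W\<close> stay within \<open>W\<close>
    and its neighbours, while \<open>U - W\<close> is below the density of \<open>U\<close> by
    minimality; the missing arcs, more than (1 + 1/r) per vertex of \<open>W\<close>, must be
    there.\<close>
  have many: "(r + 1) * card W < r * card (arcs_in F (W \<union> nbhd E W))"
    if W: "W \<subseteq> U" "W \<noteq> {}" "W \<noteq> U" for W
  proof -
    have "arcs_in F U \<subseteq> arcs_in F (U - W) \<union> arcs_in F (W \<union> nbhd E W)"
      by (auto simp: arcs_in_def nbhd_def E_def)
    then have "card (arcs_in F U) \<le> card (arcs_in F (U - W) \<union> arcs_in F (W \<union> nbhd E W))"
      by (intro card_mono) (auto simp: fF finite_arcs_in)
    also have "\<dots> \<le> card (arcs_in F (U - W)) + card (arcs_in F (W \<union> nbhd E W))"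
      by (rule card_Un_le)
    finally have "r * card (arcs_in F U) \<le> r * card (arcs_in F (U - W)) + r * card (arcs_in F (W \<union> nbhd E W))"
      by (metis add_mult_distrib2 mult_le_mono2)
    moreover have "r * card (arcs_in F (U - W)) < (r + 1) * card (U - W)"
      using W by (intro minW) auto
    moreover have "(r + 1) * card U = (r + 1) * card (U - W) + (r + 1) * card W"
      using W fU by (metis add_mult_distrib2 card_Diff_subset card_mono finite_subset le_add_diff_inverse2)
    ultimately show ?thesis using U by linarith
  qed
  have connected: "nbhd E W \<noteq> {}" if W: "W \<subseteq> U" "W \<noteq> {}" "W \<noteq> U" for W
    using many[OF W] minW[OF W] by force
  \<comment> \<open>By \<open>many\<close> and \<open>sparse\<close>, card W is less than (2r + 1)
    times the number of neighbours, which is impossible with fewer than \<open>t\<close> neighbours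
    once card W is at least (2r + 1)t. The upper limit (4r + 2)t on card W plus \<open>t\<close>
    neighbours gives the range (4r + 3)t demanded of \<open>sparse\<close>.\<close>
  have expand: "t \<le> card (nbhd E W)"
    if W: "W \<subseteq> U" "2 * (2 * r + 1) * t \<le> 2 * card W" "card W \<le> 2 * (2 * r + 1) * t" for W
  proof (rule ccontr)
    assume "\<not> ?thesis"
    then have lt: "card (nbhd E W) < t" by simp
    have "W \<noteq> {}" using W(2) t by auto
    have "2 * (2 * r + 1) * t < card U" using big t by (simp add: algebra_simps)
    then have "W \<noteq> U" using W(3) by auto
    have NU: "nbhd E W \<subseteq> U" by (auto simp: nbhd_def E_def)
    let ?S = "W \<union> nbhd E W"
    have c: "card ?S \<le> card W + card (nbhd E W)" by (rule card_Un_le)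
    then have "card ?S \<le> 2 * (2 * r + 1) * t + t" using W(3) lt by linarith
    also have "\<dots> = (4 * r + 3) * t" by (simp add: algebra_simps)
    finally have "2 * r * card (arcs_in F ?S) \<le> (2 * r + 1) * card ?S"
      using W NU U \<open>W \<noteq> {}\<close> by (intro sparse) auto
    also have "\<dots> \<le> (2 * r + 1) * (card W + card (nbhd E W))" using c by (rule mult_le_mono2)
    finally have "2 * ((r + 1) * card W) < (2 * r + 1) * (card W + card (nbhd E W))"
      using many[of W] W \<open>W \<noteq> {}\<close> \<open>W \<noteq> U\<close> by (simp add: mult.assoc)
    then have "card W < (2 * r + 1) * card (nbhd E W)" by (simp add: algebra_simps)
    also have "\<dots> \<le> (2 * r + 1) * t" using lt by (intro mult_le_mono2) simp
    finally show False using W(2) by simp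
  qed
  have "\<exists>q. distinct q \<and> t < length q \<and> successively E q \<and> E (last q) (hd q)"
  proof (rule long_cycle[where U = U and k = "2 * (2 * r + 1) * t"])
    show "E y x" if "E x y" for x y using that by (auto simp: E_def)
    show "1 \<le> 2 * (2 * r + 1) * t" using t by (cases t) auto
    show "2 * (2 * r + 1) * t < card U" using big t by (simp add: algebra_simps)
  qed (use t connected expand in \<open>auto simp: E_def\<close>)
  then obtain q where "distinct q" "t < length q" "successively E q" "E (last q) (hd q)" by blast
  moreover from this have "successively (\<lambda>x y. (x, y) \<in> F \<or> (y, x) \<in> F) q"
    by (elim successively_mono) (auto simp: E_def)
  ultimately show ?thesis by (auto simp: E_def)
qed

section \<open>From cyclic vertex sequences to monochromatic cycles\<close>

text \<open>The edges are chosen separately at every position. A repeated edge would make two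
  positions cyclic successors of each other, which three or more vertices exclude; with two
  vertices, one edge could be traversed back and forth.\<close>

lemma is_cycle_of_vertices:
  assumes "distinct q" "3 \<le> length q" "set q \<subseteq> mverts G"
    and edge: "\<And>i. i < length q \<Longrightarrow> \<exists>e\<in>medges G. mends G e = {q ! i, q ! (Suc i mod length q)}"
  shows "\<exists>es. is_cycle G q es"
proof -
  let ?L = "length q"
  obtain f where f: "\<And>i. i < ?L \<Longrightarrow> f i \<in> medges G \<and> mends G (f i) = {q ! i, q ! (Suc i mod ?L)}"
    using edge by metis
  let ?es = "map f [0..<?L]"
  have L0: "0 < ?L" using assms(2) by linarith
  have "i = j" if ij: "i < ?L" "j < ?L" "f i = f j" for i j
  proof (rule ccontr)
    assume ne: "i \<noteq> j"
    have "{q ! i, q ! (Suc i mod ?L)} = {q ! j, q ! (Suc j mod ?L)}" using f ij by metis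
    then have "q ! i = q ! (Suc j mod ?L)" "q ! j = q ! (Suc i mod ?L)"
      using ne ij \<open>distinct q\<close> by (auto simp: doubleton_eq_iff nth_eq_iff_index_eq)
    then have a: "i = Suc j mod ?L" and b: "j = Suc i mod ?L"
      using ij \<open>distinct q\<close> L0 by (simp_all add: nth_eq_iff_index_eq)
    show False
    proof (cases "Suc j = ?L")
      case True
      then have "i = 0" using a by simp
      then have "j = 1" using b assms(2) by simp
      then show False using True assms(2) by simp
    next
      case False
      then have i: "i = Suc j" using a ij by simp
      show False
      proof (cases "Suc i = ?L")
        case True
        then have "j = 0" using b by simp
        then show False using True i assms(2) by simp
      next
        case False
        then have "j = Suc i" using b ij by simp
        then show False using i by simp
      qed
    qed
  qed
  then have "distinct ?es" by (auto simp: distinct_map inj_on_def)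
  moreover have "set ?es \<subseteq> medges G" using f by auto
  ultimately have "is_cycle G q ?es"
    unfolding is_cycle_def using assms f L0 by auto
  then show ?thesis by blast
qed

lemma exists_mono_cycle:
  fixes r t n :: nat
  assumes r: "1 \<le> r" and t: "2 \<le> t" and n: "1 \<le> n"
    and A: "A \<subseteq> {1..n} \<times> {1..n}" and noloop: "\<And>a. a \<in> A \<Longrightarrow> fst a \<noteq> snd a"
    and card: "card A = (r + 1) * n"
    and sparse: "\<And>S. S \<subseteq> {1..n} \<Longrightarrow> S \<noteq> {} \<Longrightarrow> card S \<le> (4 * r + 3) * t \<Longrightarrow>
      2 * r * card (arcs_in A S) \<le> (2 * r + 1) * card S"
    and col: "edge_coloring r (forget_orientation \<lparr>pverts = {1..n}, parcs = A\<rparr>) c"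
  shows "\<exists>vs es. mono_cycle r (forget_orientation \<lparr>pverts = {1..n}, parcs = A\<rparr>) c vs es \<and> t < length es"
proof -
  let ?G = "forget_orientation \<lparr>pverts = {1..n}, parcs = A\<rparr>"
  have fA: "finite A" using A finite_subset by blast
  define F where "F i = {e \<in> A. c e = i}" for i
  have cc: "c e \<in> {1..r}" if "e \<in> A" for e
    using col that by (auto simp: edge_coloring_def forget_orientation_def Pi_iff)
  have "A = (\<Union>i\<in>{1..r}. F i)" using cc by (auto simp: F_def)
  then have "card A = card (\<Union>i\<in>{1..r}. F i)" by simp
  also have "\<dots> = (\<Sum>i\<in>{1..r}. card (F i))"
    using fA by (intro card_UN_disjoint) (auto simp: F_def)
  finally have sum: "(\<Sum>i\<in>{1..r}. card (F i)) = (r + 1) * n" using card by simp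
  have "\<exists>i\<in>{1..r}. (r + 1) * n \<le> r * card (F i)"
  proof (rule ccontr)
    assume "\<not> ?thesis"
    then have "(\<Sum>i\<in>{1..r}. r * card (F i)) < (\<Sum>i\<in>{1..r}. (r + 1) * n)"
      using r by (intro sum_strict_mono) (auto simp: not_le)
    then show False using sum by (simp flip: sum_distrib_left)
  qed
  then obtain i where i: "i \<in> {1..r}" "(r + 1) * n \<le> r * card (F i)" by blast
  have FA: "F i \<subseteq> A" by (auto simp: F_def)
  have "\<exists>q. distinct q \<and> t < length q \<and> successively (\<lambda>x y. (x, y) \<in> F i \<or> (y, x) \<in> F i) q \<and>
    ((last q, hd q) \<in> F i \<or> (hd q, last q) \<in> F i)"
  proof (rule dense_locally_sparse_long_cycle)
    fix S :: "nat set" assume S: "S \<subseteq> {1..n}" "S \<noteq> {}" "card S \<le> (4 * r + 3) * t"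
    have "card (arcs_in (F i) S) \<le> card (arcs_in A S)"
      using fA FA by (intro card_mono finite_arcs_in) (auto simp: arcs_in_def)
    then have "2 * r * card (arcs_in (F i) S) \<le> 2 * r * card (arcs_in A S)" by (rule mult_le_mono2)
    then show "2 * r * card (arcs_in (F i) S) \<le> (2 * r + 1) * card S"
      using sparse[OF S] by linarith
  qed (use r t i n FA A in auto)
  then obtain q where q: "distinct q" "t < length q"
    "successively (\<lambda>x y. (x, y) \<in> F i \<or> (y, x) \<in> F i) q" "(last q, hd q) \<in> F i \<or> (hd q, last q) \<in> F i"
    by blast
  let ?H = "color_subgraph ?G c i"
  have H: "mverts ?H = \<Union> ((\<lambda>(u, v). {u, v}) ` F i)" "medges ?H = F i" "mends ?H = (\<lambda>(u, v). {u, v})"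
    by (simp_all add: color_subgraph_def forget_orientation_def F_def Let_def)
  have q0: "q \<noteq> []" using q(2) by auto
  have edge: "(q ! j, q ! (Suc j mod length q)) \<in> F i \<or> (q ! (Suc j mod length q), q ! j) \<in> F i"
    if j: "j < length q" for j
  proof (cases "Suc j = length q")
    case True
    then have "length q - 1 = j" by linarith
    then have "last q = q ! j" "hd q = q ! 0" using q0 by (simp_all add: last_conv_nth hd_conv_nth)
    then show ?thesis using q(4) True by simp
  next
    case False
    then show ?thesis using q(3) j by (simp add: successively_conv_nth)
  qed
  have "\<exists>es. is_cycle ?H q es"
  proof (rule is_cycle_of_vertices)
    show "set q \<subseteq> mverts ?H"
    proof
      fix x assume "x \<in> set q"
      then obtain j where "j < length q" "x = q ! j" by (auto simp: in_set_conv_nth)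
      then show "x \<in> mverts ?H" using edge[of j] unfolding H by force
    qed
    fix j assume "j < length q"
    from edge[OF this] show "\<exists>e\<in>medges ?H. mends ?H e = {q ! j, q ! (Suc j mod length q)}"
      unfolding H by (auto simp: insert_commute intro: bexI[rotated])
  qed (use q t in auto)
  then obtain es where es: "is_cycle ?H q es" by blast
  then have "length es = length q" by (simp add: is_cycle_def)
  then show ?thesis using es i(1) q(2) unfolding mono_cycle_def by metis
qed

section \<open>Local sparsity of the random digraph\<close>

text \<open>\<open>a^a / a!\<close> is a single term of the exponential series at \<open>a\<close>,
  and exp 1 is at most 3.\<close>

lemma power_self_le_fact: "real a ^ a \<le> 3 ^ a * fact a"
proof -
  have "(\<Sum>i\<in>{a}. real a ^ i /\<^sub>R fact i) \<le> (\<Sum>i. real a ^ i /\<^sub>R fact i)"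
    by (intro sum_le_suminf summable_exp_generic) auto
  then have "real a ^ a / fact a \<le> exp (real a)"
    by (simp add: exp_def divide_inverse mult.commute)
  also have "\<dots> = exp 1 ^ a" by (simp flip: exp_of_nat_mult)
  also have "\<dots> \<le> 3 ^ a" by (intro power_mono exp_le) auto
  finally show ?thesis by (simp add: divide_le_eq)
qed

lemma binomial_le_power: "real (n choose s) * real s ^ s \<le> (3 * real n) ^ s"
proof -
  have "real ((n choose s) * fact s) \<le> real (n ^ s)"
    using binomial_fact_pow[of n s] by (intro of_nat_mono)
  then have b: "real (n choose s) * fact s \<le> real n ^ s" by simp
  have "real (n choose s) * real s ^ s \<le> real (n choose s) * (3 ^ s * fact s)"
    by (intro mult_left_mono power_self_le_fact) auto
  also have "\<dots> = 3 ^ s * (real (n choose s) * fact s)" by simp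
  also have "\<dots> \<le> 3 ^ s * real n ^ s" by (intro mult_left_mono b) auto
  finally show ?thesis by (simp add: power_mult_distrib)
qed

text \<open>The quotient of the two binomials is the probability that a uniform
  \<open>k\<close>-subset of \<open>N\<close> points contains \<open>j\<close> given points. Its
  factors (k - i)/(N - i) are at most k/N because \<open>k \<le> N\<close>.\<close>

lemma binomial_diff_le:
  "j \<le> k \<Longrightarrow> k \<le> N \<Longrightarrow> real ((N - j) choose (k - j)) \<le> (real k / real N) ^ j * real (N choose k)"
proof (induction j arbitrary: N k)
  case 0
  then show ?case by simp
next
  case (Suc j)
  then obtain k' N' where e: "k = Suc k'" "N = Suc N'" by (metis Suc_le_D le_trans)
  have "real ((N' - j) choose (k' - j)) \<le> (real k' / real N') ^ j * real (N' choose k')"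
    using Suc e by (intro Suc.IH) auto
  also have "\<dots> \<le> (real k / real N) ^ j * real (N' choose k')"
  proof (intro mult_right_mono power_mono)
    show "real k' / real N' \<le> real k / real N"
      using Suc.prems e by (cases "N' = 0") (auto simp: field_simps)
  qed auto
  also have "real (N' choose k') = real k / real N * real (N choose k)"
    using Suc_times_binomial_eq[of N' k'] e
    by (simp add: field_simps del: binomial_Suc_Suc of_nat_Suc flip: of_nat_mult)
  finally show ?case using e by (simp add: mult_ac)
qed

lemma card_supersets:
  assumes "finite A" "T \<subseteq> A" "card T \<le> k"
  shows "card {S. S \<subseteq> A \<and> card S = k \<and> T \<subseteq> S} = (card A - card T) choose (k - card T)"
proof -
  have fT: "finite T" using assms finite_subset by blast
  have "bij_betw (\<lambda>S. S - T) {S. S \<subseteq> A \<and> card S = k \<and> T \<subseteq> S} {S. S \<subseteq> A - T \<and> card S = k - card T}"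
  proof (rule bij_betwI[where g = "\<lambda>S. S \<union> T"])
    show "(\<lambda>S. S \<union> T) \<in> {S. S \<subseteq> A - T \<and> card S = k - card T} \<rightarrow> {S. S \<subseteq> A \<and> card S = k \<and> T \<subseteq> S}"
    proof
      fix S assume S: "S \<in> {S. S \<subseteq> A - T \<and> card S = k - card T}"
      then have "finite S" using assms(1) by (auto intro: finite_subset)
      then have "card (S \<union> T) = card S + card T" using S fT by (intro card_Un_disjoint) auto
      then show "S \<union> T \<in> {S. S \<subseteq> A \<and> card S = k \<and> T \<subseteq> S}" using S assms by auto
    qed
  qed (use fT in \<open>auto simp: card_Diff_subset\<close>)
  then have "card {S. S \<subseteq> A \<and> card S = k \<and> T \<subseteq> S} = card {S. S \<subseteq> A - T \<and> card S = k - card T}"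
    by (rule bij_betw_same_card)
  also have "\<dots> = card (A - T) choose (k - card T)"
    using assms by (intro n_subsets) auto
  finally show ?thesis using assms fT by (simp add: card_Diff_subset)
qed

lemma finite_k_subsets: "finite A \<Longrightarrow> finite {S. S \<subseteq> A \<and> card S = k}"
  by (rule finite_subset[of _ "Pow A"]) auto

lemma k_subsets_nonempty: "k \<le> card A \<Longrightarrow> {S. S \<subseteq> A \<and> card S = k} \<noteq> {}"
  using obtain_subset_with_card_n by blast

lemma prob_superset_le:
  assumes "finite A" "k \<le> card A" "T \<subseteq> A"
  shows "measure_pmf.prob (pmf_of_set {S. S \<subseteq> A \<and> card S = k}) {S. T \<subseteq> S} \<le> (real k / real (card A)) ^ card T"
proof -
  let ?X = "{S. S \<subseteq> A \<and> card S = k}"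
  have X: "finite ?X" "?X \<noteq> {}"
    using assms finite_k_subsets k_subsets_nonempty by auto
  have eq: "?X \<inter> {S. T \<subseteq> S} = {S. S \<subseteq> A \<and> card S = k \<and> T \<subseteq> S}" by auto
  have cX: "card ?X = card A choose k" using assms by (intro n_subsets)
  have pos: "0 < card A choose k" using assms by simp
  have le: "real (card (?X \<inter> {S. T \<subseteq> S})) \<le> (real k / real (card A)) ^ card T * real (card A choose k)"
  proof (cases "card T \<le> k")
    case True
    then show ?thesis using card_supersets[OF assms(1,3)] binomial_diff_le[of "card T" k "card A"] assms eq
      by simp
  next
    case False
    have "?X \<inter> {S. T \<subseteq> S} = {}"
    proof (rule ccontr)
      assume "\<not> ?thesis"
      then obtain S where "S \<subseteq> A" "card S = k" "T \<subseteq> S" by auto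
      then show False using False assms card_mono finite_subset by metis
    qed
    then show ?thesis by (metis card.empty mult_nonneg_nonneg of_nat_0 of_nat_0_le_iff zero_le_power divide_nonneg_nonneg)
  qed
  have "measure_pmf.prob (pmf_of_set ?X) {S. T \<subseteq> S} = real (card (?X \<inter> {S. T \<subseteq> S})) / real (card ?X)"
    using X by (simp add: measure_pmf_of_set)
  also have "\<dots> \<le> (real k / real (card A)) ^ card T"
    using le pos unfolding cX by (simp add: divide_le_eq)
  finally show ?thesis .
qed

definition out_sets :: "nat \<Rightarrow> nat \<Rightarrow> (nat \<Rightarrow> nat set) pmf" where
  "out_sets n k = Pi_pmf {1..n} {} (\<lambda>u. pmf_of_set {S. S \<subseteq> {1..n} - {u} \<and> card S = k})"

text \<open>Out-sets of different vertices are independent, so the probability factors over the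
  tails; the exponents add up to the number of arcs.\<close>

lemma prob_arcs_subset_le:
  assumes k: "k < n" and F: "F \<subseteq> {1..n} \<times> {1..n}" and noloop: "\<And>a. a \<in> F \<Longrightarrow> fst a \<noteq> snd a"
  shows "measure_pmf.prob (out_sets n k) {N. F \<subseteq> Sigma {1..n} N} \<le> (real k / real (n - 1)) ^ card F"
proof -
  have fF: "finite F" using F finite_subset by blast
  have "{N. F \<subseteq> Sigma {1..n} N} = Pi {1..n} (\<lambda>u. {S. F `` {u} \<subseteq> S})"
    using F by (auto simp: Pi_iff)
  then have "measure_pmf.prob (out_sets n k) {N. F \<subseteq> Sigma {1..n} N} =
    (\<Prod>u\<in>{1..n}. measure_pmf.prob (pmf_of_set {S. S \<subseteq> {1..n} - {u} \<and> card S = k}) {S. F `` {u} \<subseteq> S})"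
    unfolding out_sets_def by (simp add: measure_Pi_pmf_Pi)
  also have "\<dots> \<le> (\<Prod>u\<in>{1..n}. (real k / real (n - 1)) ^ card (F `` {u}))"
  proof (intro prod_mono conjI)
    fix u assume u: "u \<in> {1..n}"
    then have c: "card ({1..n} - {u}) = n - 1" by simp
    have "measure_pmf.prob (pmf_of_set {S. S \<subseteq> {1..n} - {u} \<and> card S = k}) {S. F `` {u} \<subseteq> S}
      \<le> (real k / real (card ({1..n} - {u}))) ^ card (F `` {u})"
      using k F noloop c by (intro prob_superset_le) fastforce+
    then show "measure_pmf.prob (pmf_of_set {S. S \<subseteq> {1..n} - {u} \<and> card S = k}) {S. F `` {u} \<subseteq> S}
      \<le> (real k / real (n - 1)) ^ card (F `` {u})" unfolding c .
  qed simp
  also have "\<dots> = (real k / real (n - 1)) ^ (\<Sum>u\<in>{1..n}. card (F `` {u}))"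
    by (simp add: power_sum)
  also have "(\<Sum>u\<in>{1..n}. card (F `` {u})) = card (SIGMA u:{1..n}. F `` {u})"
    using fF by (intro card_SigmaI[symmetric]) auto
  also have "(SIGMA u:{1..n}. F `` {u}) = F" using F by auto
  finally show ?thesis .
qed

definition locally_sparse :: "nat \<Rightarrow> nat \<Rightarrow> nat \<Rightarrow> (nat \<times> nat) set \<Rightarrow> bool" where
  "locally_sparse r n m A \<longleftrightarrow> (\<forall>S\<subseteq>{1..n}. S \<noteq> {} \<longrightarrow> card S \<le> m \<longrightarrow>
     2 * r * card (arcs_in A S) \<le> (2 * r + 1) * card S)"

text \<open>The least integer exceeding \<open>(1 + 1/(2r)) s\<close>.\<close>

definition excess_size :: "nat \<Rightarrow> nat \<Rightarrow> nat" where
  "excess_size r s = s + (s div (2 * r) + 1)"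

lemma excess_size_le:
  assumes "1 \<le> r" and "(2 * r + 1) * s < 2 * r * e"
  shows "excess_size r s \<le> e"
proof (rule ccontr)
  assume "\<not> ?thesis"
  then have "e \<le> s + s div (2 * r)" by (simp add: excess_size_def)
  then have "2 * r * e \<le> 2 * r * (s + s div (2 * r))" by (rule mult_le_mono2)
  also have "\<dots> = 2 * r * s + 2 * r * (s div (2 * r))" by (rule add_mult_distrib2)
  also have "\<dots> \<le> 2 * r * s + s" by simp
  finally show False using assms(2) by simp
qed

lemma prob_UN_le_sum:
  "finite I \<Longrightarrow> measure_pmf.prob M (\<Union>i\<in>I. B i) \<le> (\<Sum>i\<in>I. measure_pmf.prob M (B i))"
  by (intro measure_pmf.finite_measure_subadditive_finite) auto

text \<open>Union bound over the \<open>a\<close>-subsets of \<open>S \<times> S\<close>. The clause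
  \<open>u \<notin> N u\<close>, true on the support, confines the union to loopless arc sets, to
  which the product bound applies.\<close>

lemma prob_dense_set_le:
  assumes k: "k < n" and S: "S \<subseteq> {1..n}"
  shows "measure_pmf.prob (out_sets n k) {N. a \<le> card (arcs_in (Sigma {1..n} N) S) \<and> (\<forall>u. u \<notin> N u)}
    \<le> real ((card S)\<^sup>2 choose a) * (real k / real (n - 1)) ^ a"
proof -
  let ?X = "{F. F \<subseteq> S \<times> S \<and> card F = a}"
  let ?Y = "{F\<in>?X. \<forall>e\<in>F. fst e \<noteq> snd e}"
  have fS: "finite S" using S finite_subset by blast
  then have fX: "finite ?X" by (intro finite_k_subsets) auto
  have "{N. a \<le> card (arcs_in (Sigma {1..n} N) S) \<and> (\<forall>u. u \<notin> N u)} \<subseteq> (\<Union>F\<in>?Y. {N. F \<subseteq> Sigma {1..n} N})"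
  proof
    fix N assume "N \<in> {N. a \<le> card (arcs_in (Sigma {1..n} N) S) \<and> (\<forall>u. u \<notin> N u)}"
    then have N: "a \<le> card (arcs_in (Sigma {1..n} N) S)" "\<And>u. u \<notin> N u" by auto
    then obtain F where F: "F \<subseteq> arcs_in (Sigma {1..n} N) S" "card F = a"
      using obtain_subset_with_card_n by metis
    then have "F \<in> ?Y" using N(2) by (fastforce simp: arcs_in_def)
    moreover have "F \<subseteq> Sigma {1..n} N" using F(1) unfolding arcs_in_def by blast
    ultimately show "N \<in> (\<Union>F\<in>?Y. {N. F \<subseteq> Sigma {1..n} N})" by blast
  qed
  then have "measure_pmf.prob (out_sets n k) {N. a \<le> card (arcs_in (Sigma {1..n} N) S) \<and> (\<forall>u. u \<notin> N u)}
    \<le> measure_pmf.prob (out_sets n k) (\<Union>F\<in>?Y. {N. F \<subseteq> Sigma {1..n} N})"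
    by (intro measure_pmf.finite_measure_mono) auto
  also have "\<dots> \<le> (\<Sum>F\<in>?Y. measure_pmf.prob (out_sets n k) {N. F \<subseteq> Sigma {1..n} N})"
    by (intro prob_UN_le_sum finite_subset[OF _ fX]) auto
  also have "\<dots> \<le> (\<Sum>F\<in>?Y. (real k / real (n - 1)) ^ a)"
  proof (rule sum_mono)
    fix F assume F: "F \<in> ?Y"
    then show "measure_pmf.prob (out_sets n k) {N. F \<subseteq> Sigma {1..n} N} \<le> (real k / real (n - 1)) ^ a"
      using prob_arcs_subset_le[OF k, of F] S by blast
  qed
  also have "\<dots> \<le> (\<Sum>F\<in>?X. (real k / real (n - 1)) ^ a)"
    using fX by (intro sum_mono2) auto
  also have "\<dots> = real (card ?X) * (real k / real (n - 1)) ^ a" by simp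
  also have "card ?X = card (S \<times> S) choose a" using fS by (intro n_subsets) auto
  finally show ?thesis by (simp add: card_cartesian_product power2_eq_square)
qed

text \<open>Since \<open>a \<ge> s\<close>, the binomial estimate gives \<open>(3 s)^a\<close> for
  the choice of arcs, and with \<open>n - 1 \<ge> n / 2\<close> the arc factor is at most
  \<open>y^a\<close> for y = 6ks/n. The choice of the vertex set costs \<open>(3 n / s)^s\<close>,
  which cancels \<open>y^s\<close> up to \<open>(18 k)^s\<close>.\<close>

lemma excess_term_le:
  fixes r s n k :: nat
  assumes r: "1 \<le> r" and s: "1 \<le> s" and k: "1 \<le> k" and n: "2 \<le> n"
    and a: "a = excess_size r s"
    and small: "(18 * real k) ^ (2 * r) * (6 * real k) * real s \<le> real n / 2"
  shows "real (n choose s) * (real (s\<^sup>2 choose a) * (real k / real (n - 1)) ^ a)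
    \<le> (18 * real k) ^ (2 * r) * (6 * real k) * real s / real n * (1 / 2) ^ (s div (2 * r))"
proof -
  \<comment> \<open>The excess of \<open>a\<close> over \<open>s\<close>. As
    \<open>s \<le> 2 * r * b\<close>, the factor \<open>(18 k)^s\<close> is absorbed into
    \<open>C^b\<close>.\<close>
  define b where "b = s div (2 * r) + 1"
  define y where "y = 6 * real k * real s / real n"
  define C where "C = (18 * real k) ^ (2 * r)"
  have ab: "a = s + b" by (simp add: a excess_size_def b_def)
  have n0: "0 < real n" and s0: "0 < real s" using n s by auto
  have y0: "0 \<le> y" by (simp add: y_def)
  have C1: "1 \<le> C" unfolding C_def using k by (intro one_le_power) auto
  have Cy: "C * y \<le> 1 / 2" using small n0 by (simp add: C_def y_def field_simps)
  have "real (s\<^sup>2 choose a) * real a ^ a \<le> (3 * real (s\<^sup>2)) ^ a" by (rule binomial_le_power)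
  moreover have "real s ^ a \<le> real a ^ a" using ab by (intro power_mono) auto
  ultimately have "real (s\<^sup>2 choose a) * real s ^ a \<le> (3 * real (s\<^sup>2)) ^ a"
    by (meson mult_left_mono of_nat_0_le_iff order_trans)
  also have "\<dots> = (3 * real s) ^ a * real s ^ a"
    by (simp add: power2_eq_square power_mult_distrib)
  finally have c1: "real (s\<^sup>2 choose a) \<le> (3 * real s) ^ a" using s0 by simp
  have "real k / real (n - 1) \<le> 2 * real k / real n"
    using n k by (simp add: field_simps of_nat_diff)
  then have "(real k / real (n - 1)) ^ a \<le> (2 * real k / real n) ^ a" by (intro power_mono) auto
  then have "real (s\<^sup>2 choose a) * (real k / real (n - 1)) ^ a \<le> (3 * real s) ^ a * (2 * real k / real n) ^ a"
    using c1 by (intro mult_mono) auto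
  also have "\<dots> = (3 * real s * (2 * real k / real n)) ^ a" by (rule power_mult_distrib[symmetric])
  also have "3 * real s * (2 * real k / real n) = y" by (simp add: y_def)
  finally have c2: "real (s\<^sup>2 choose a) * (real k / real (n - 1)) ^ a \<le> y ^ a" .
  have "real (n choose s) \<le> (3 * real n / real s) ^ s"
    using binomial_le_power[of n s] s0 by (simp add: power_divide pos_le_divide_eq)
  then have "real (n choose s) * (real (s\<^sup>2 choose a) * (real k / real (n - 1)) ^ a) \<le> (3 * real n / real s) ^ s * y ^ a"
    using c2 by (intro mult_mono) auto
  also have "\<dots> = (3 * real n / real s * y) ^ s * y ^ b"
    by (simp only: ab power_add power_mult_distrib mult.assoc)
  also have "3 * real n / real s * y = 18 * real k" using n0 s0 by (simp add: y_def)
  also have "(18 * real k) ^ s \<le> (18 * real k) ^ (2 * r * b)"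
  proof (rule power_increasing)
    have "s mod (2 * r) < 2 * r" using r by simp
    moreover have "s = 2 * r * (s div (2 * r)) + s mod (2 * r)" by simp
    ultimately show "s \<le> 2 * r * b" unfolding b_def by (simp add: algebra_simps)
  qed (use k in auto)
  also have "(18 * real k) ^ (2 * r * b) * y ^ b = (C * y) ^ b"
    by (simp add: C_def power_mult power_mult_distrib)
  \<comment> \<open>One factor \<open>C * y\<close>, of order s/n, is kept: it makes the sum over
    all \<open>s\<close> of order 1/n. The others are at most 1/2.\<close>
  also have "\<dots> = C * y * (C * y) ^ (s div (2 * r))" by (simp add: b_def)
  also have "\<dots> \<le> C * y * (1 / 2) ^ (s div (2 * r))"
    using Cy y0 C1 by (intro mult_left_mono power_mono) auto
  finally show ?thesis using y0 by (simp add: C_def y_def mult_right_mono)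
qed

text \<open>Comparison with twice the derivative of the geometric series of ratio
  \<open>(1/2) powr (1/d)\<close>; the 2 pays for rounding s/d down.\<close>

lemma summable_geometric_blocks:
  assumes "1 \<le> d"
  shows "summable (\<lambda>s. real s * (1 / 2) ^ (s div d))"
proof (rule summable_comparison_test')
  define \<rho> where "\<rho> = (1 / 2 :: real) powr (1 / real d)"
  have d0: "0 < real d" using assms by simp
  have \<rho>: "0 < \<rho>" "\<rho> < 1" using d0 powr_less_mono2[of "1 / real d" "1 / 2" 1] unfolding \<rho>_def by auto
  have "summable (\<lambda>s. of_nat (Suc s) * \<rho> ^ s)"
    using geometric_deriv_sums[of \<rho>] \<rho> by (auto simp: sums_iff)
  then show "summable (\<lambda>s. 2 * (of_nat (Suc s) * \<rho> ^ s))" by (rule summable_mult)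
  fix s :: nat assume "0 \<le> s"
  have "s < d * (s div d) + d"
    using assms by (metis add.commute dividend_less_div_times mult.commute less_le_trans zero_less_one)
  then have "real s < real d * real (s div d) + real d" by (metis of_nat_add of_nat_less_iff of_nat_mult)
  then have e: "real s / real d - 1 \<le> real (s div d)" using d0 by (simp add: field_simps)
  have "(1 / 2 :: real) ^ (s div d) = (1 / 2) powr real (s div d)" by (simp add: powr_realpow)
  also have "\<dots> \<le> (1 / 2) powr (real s / real d - 1)" using e by (intro powr_mono') auto
  also have "\<dots> = 2 * (1 / 2) powr (real s / real d)" by (simp add: powr_diff)
  also have "(1 / 2) powr (real s / real d) = \<rho> ^ s"
    unfolding \<rho>_def using d0 by (simp add: powr_powr flip: powr_realpow)
  finally have "real s * (1 / 2) ^ (s div d) \<le> real (Suc s) * (2 * \<rho> ^ s)"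
    using \<rho> by (intro mult_mono) auto
  then show "norm (real s * (1 / 2) ^ (s div d)) \<le> 2 * (of_nat (Suc s) * \<rho> ^ s)"
    by (simp add: mult_ac)
qed

section \<open>Failure probabilities and the proof of (ii)\<close>

lemma whpI:
  assumes "\<forall>\<^sub>F n in sequentially. measure_pmf.prob (M n) {x. \<not> P n x} \<le> b n" and "b \<longlonglongrightarrow> 0"
  shows "whp M P"
proof -
  have eq: "measure_pmf.prob (M n) {x. P n x} = 1 - measure_pmf.prob (M n) {x. \<not> P n x}" for n
    using measure_pmf.prob_compl[of "{x. \<not> P n x}" "M n"] by (simp add: Compl_eq_Diff_UNIV[symmetric] Collect_neg_eq)
  have "(\<lambda>n. measure_pmf.prob (M n) {x. \<not> P n x}) \<longlonglongrightarrow> 0"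
    by (rule real_tendsto_sandwich[OF _ assms(1) tendsto_const assms(2)]) auto
  then have "(\<lambda>n. 1 - measure_pmf.prob (M n) {x. \<not> P n x}) \<longlonglongrightarrow> 1 - 0"
    by (intro tendsto_diff tendsto_const)
  then show ?thesis unfolding whp_def eq by simp
qed

lemma prob_mono_support:
  assumes "\<And>x. x \<in> set_pmf M \<Longrightarrow> P x \<Longrightarrow> Q x"
  shows "measure_pmf.prob M {x. P x} \<le> measure_pmf.prob M {x. Q x}"
  using assms by (intro measure_pmf.finite_measure_mono_AE) (auto simp: AE_measure_pmf_iff)

lemma out_sets_support:
  assumes "N \<in> set_pmf (out_sets n k)" and "k < n"
  shows "u \<in> {1..n} \<Longrightarrow> N u \<subseteq> {1..n} - {u} \<and> card (N u) = k"
    and "u \<notin> N u"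
proof -
  have ne: "{S. S \<subseteq> {1..n} - {u} \<and> card S = k} \<noteq> {}" if "u \<in> {1..n}" for u
    using assms(2) that by (intro k_subsets_nonempty) auto
  have fin: "finite {S. S \<subseteq> {1..n} - {u} \<and> card S = k}" for u
    by (intro finite_k_subsets) auto
  have N: "N u \<in> {S. S \<subseteq> {1..n} - {u} \<and> card S = k}" if "u \<in> {1..n}" for u
  proof -
    have "N u \<in> set_pmf (pmf_of_set {S. S \<subseteq> {1..n} - {u} \<and> card S = k})"
      using assms(1) that unfolding out_sets_def by (auto simp: set_Pi_pmf PiE_dflt_def)
    then show ?thesis using ne[OF that] fin by (simp add: set_pmf_of_set)
  qed
  then show "u \<in> {1..n} \<Longrightarrow> N u \<subseteq> {1..n} - {u} \<and> card (N u) = k" by blast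
  have "N u = {}" if "u \<notin> {1..n}" for u
    using assms(1) that unfolding out_sets_def by (auto simp: set_Pi_pmf PiE_dflt_def)
  then show "u \<notin> N u" using N by blast
qed

text \<open>First moment over all vertex sets, grouped by size \<open>s\<close>. The bound on
  \<open>m\<close> keeps every size in the range where the terms decay geometrically, so one
  convergent series, independent of \<open>n\<close>, bounds the sum up to a factor of order
  1/n.\<close>

lemma prob_not_locally_sparse_le:
  fixes r n k m :: nat
  assumes r: "1 \<le> r" and k: "1 \<le> k" "k < n"
    and m: "(18 * real k) ^ (2 * r) * (6 * real k) * real m \<le> real n / 2"
  shows "measure_pmf.prob (out_sets n k) {N. \<not> locally_sparse r n m (Sigma {1..n} N)} \<le>
    (18 * real k) ^ (2 * r) * (6 * real k) * (\<Sum>s. real s * (1 / 2) ^ (s div (2 * r))) / real n"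
proof -
  define C where "C = (18 * real k) ^ (2 * r) * (6 * real k)"
  define I where "I s = {S. S \<subseteq> {1..n} \<and> card S = s}" for s
  define B where "B S = {N. excess_size r (card S) \<le> card (arcs_in (Sigma {1..n} N) S) \<and> (\<forall>u. u \<notin> N u)}"
    for S :: "nat set"
  have fI: "finite (I s)" for s unfolding I_def by (intro finite_k_subsets) auto
  have C0: "0 \<le> C" by (simp add: C_def)
  have "measure_pmf.prob (out_sets n k) {N. \<not> locally_sparse r n m (Sigma {1..n} N)}
    \<le> measure_pmf.prob (out_sets n k) {N. N \<in> (\<Union>s\<in>{1..m}. \<Union>S\<in>I s. B S)}"
  proof (rule prob_mono_support)
    fix N assume N: "N \<in> set_pmf (out_sets n k)" and "\<not> locally_sparse r n m (Sigma {1..n} N)"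
    then obtain S where S: "S \<subseteq> {1..n}" "S \<noteq> {}" "card S \<le> m"
      "(2 * r + 1) * card S < 2 * r * card (arcs_in (Sigma {1..n} N) S)"
      unfolding locally_sparse_def by (auto simp: not_le)
    have "N \<in> B S" using excess_size_le[OF r S(4)] out_sets_support(2)[OF N k(2)] by (simp add: B_def)
    moreover have "finite S" using S(1) finite_subset by blast
    then have "card S \<in> {1..m}" using S by (simp add: Suc_le_eq card_gt_0_iff)
    ultimately show "N \<in> (\<Union>s\<in>{1..m}. \<Union>S\<in>I s. B S)" using S(1) unfolding I_def by blast
  qed
  also have "\<dots> \<le> (\<Sum>s\<in>{1..m}. measure_pmf.prob (out_sets n k) (\<Union>S\<in>I s. B S))"
    unfolding Collect_mem_eq by (intro prob_UN_le_sum) auto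
  also have "\<dots> \<le> (\<Sum>s\<in>{1..m}. \<Sum>S\<in>I s. measure_pmf.prob (out_sets n k) (B S))"
    by (intro sum_mono prob_UN_le_sum fI)
  also have "\<dots> \<le> (\<Sum>s\<in>{1..m}. C / real n * (real s * (1 / 2) ^ (s div (2 * r))))"
  proof (rule sum_mono)
    fix s assume s: "s \<in> {1..m}"
    have "(\<Sum>S\<in>I s. measure_pmf.prob (out_sets n k) (B S)) \<le>
      (\<Sum>S\<in>I s. real (s\<^sup>2 choose excess_size r s) * (real k / real (n - 1)) ^ excess_size r s)"
    proof (rule sum_mono)
      fix S assume S: "S \<in> I s"
      then show "measure_pmf.prob (out_sets n k) (B S) \<le>
        real (s\<^sup>2 choose excess_size r s) * (real k / real (n - 1)) ^ excess_size r s"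
        using prob_dense_set_le[OF k(2), of S "excess_size r s"] by (simp add: I_def B_def)
    qed
    also have "\<dots> = real (n choose s) * (real (s\<^sup>2 choose excess_size r s) * (real k / real (n - 1)) ^ excess_size r s)"
      using n_subsets[of "{1..n}" s] by (simp add: I_def)
    also have "\<dots> \<le> C * real s / real n * (1 / 2) ^ (s div (2 * r))"
      unfolding C_def
    proof (rule excess_term_le)
      have "(18 * real k) ^ (2 * r) * (6 * real k) * real s \<le> (18 * real k) ^ (2 * r) * (6 * real k) * real m"
        using s by (intro mult_left_mono) auto
      then show "(18 * real k) ^ (2 * r) * (6 * real k) * real s \<le> real n / 2" using m by linarith
    qed (use r s k in auto)
    finally show "(\<Sum>S\<in>I s. measure_pmf.prob (out_sets n k) (B S)) \<le> C / real n * (real s * (1 / 2) ^ (s div (2 * r)))"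
      by simp
  qed
  also have "\<dots> = C / real n * (\<Sum>s\<in>{1..m}. real s * (1 / 2) ^ (s div (2 * r)))"
    by (simp only: sum_distrib_left)
  also have "\<dots> \<le> C / real n * (\<Sum>s. real s * (1 / 2) ^ (s div (2 * r)))"
    using r C0 by (intro mult_left_mono sum_le_suminf summable_geometric_blocks) auto
  finally show ?thesis by (simp add: C_def)
qed

lemma k_out_graph_eq:
  "k_out_graph n k = map_pmf (\<lambda>N. forget_orientation \<lparr>pverts = {1..n}, parcs = Sigma {1..n} N\<rparr>) (out_sets n k)"
  unfolding k_out_graph_def k_out_digraph_def out_sets_def by (simp add: pmf.map_comp o_def)

lemma whp_long_mono_cycle:
  fixes r :: nat
  assumes r: "1 \<le> r"
  shows "\<exists>\<gamma>::real. \<gamma> > 0 \<and> whp (\<lambda>n. k_out_graph n (r + 1))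
      (\<lambda>n G. \<forall>c. edge_coloring r G c \<longrightarrow>
         (\<exists>vs es. mono_cycle r G c vs es \<and> real (length es) \<ge> \<gamma> * real n))"
proof -
  define k where "k = r + 1"
  define C where "C = (18 * real k) ^ (2 * r) * (6 * real k)"
  define K where "K = C * (\<Sum>s. real s * (1 / 2) ^ (s div (2 * r)))"
  define \<gamma> where "\<gamma> = 1 / (2 * C * real (4 * r + 3))"
  \<comment> \<open>The largest size that the first moment bound permits; \<open>t\<close> divides
    it by the factor 4r + 3 of the expansion argument.\<close>
  define m where "m n = nat \<lfloor>real n / (2 * C)\<rfloor>" for n
  define t where "t n = m n div (4 * r + 3)" for n
  have C0: "0 < C" by (simp add: C_def k_def)
  have \<gamma>0: "0 < \<gamma>" using C0 by (simp add: \<gamma>_def)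
  have mn: "C * real (m n) \<le> real n / 2" for n
  proof -
    have "real (m n) \<le> real n / (2 * C)" unfolding m_def using C0 by (simp add: of_nat_nat)
    then show ?thesis using C0 by (simp add: field_simps)
  qed
  \<comment> \<open>A cycle longer than \<open>t n\<close> has at least \<open>t n + 1\<close>
    edges, and this 1 absorbs the rounding in \<open>m\<close> and \<open>t\<close>.\<close>
  have tn: "\<gamma> * real n \<le> real (t n) + 1" for n
  proof -
    have "real n / (2 * C) \<le> real (m n) + 1" unfolding m_def using C0 by (simp add: of_nat_nat)
    moreover have "m n < (4 * r + 3) + (4 * r + 3) * t n"
      unfolding t_def by (rule dividend_less_times_div) simp
    then have "m n + 1 \<le> (4 * r + 3) * (t n + 1)" by simp
    then have "real (m n) + 1 \<le> real (4 * r + 3) * (real (t n) + 1)"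
      by (simp only: of_nat_add of_nat_mult of_nat_1 flip: of_nat_le_iff[where 'a = real])
    ultimately have "real n / (2 * C) \<le> real (4 * r + 3) * (real (t n) + 1)" by linarith
    moreover have "1 / (2 * C * c) * x \<le> y" if "x / (2 * C) \<le> c * y" "0 < c" for c x y
      using that C0 by (simp add: field_simps)
    ultimately show ?thesis unfolding \<gamma>_def by simp
  qed
  \<comment> \<open>From \<open>2 < \<gamma> * n\<close> and \<open>tn\<close>, \<open>t n\<close>
    is at least 2, so that the cycles have three or more vertices.\<close>
  have "\<forall>\<^sub>F n in sequentially. 2 / \<gamma> + real k + 1 \<le> real n"
    by real_asymp
  then have ev: "\<forall>\<^sub>F n in sequentially. k < n \<and> 2 \<le> t n"
  proof (eventually_elim)
    case (elim n)
    have "2 / \<gamma> < real n" "k < n" using elim \<gamma>0 by (auto simp: add_pos_nonneg) (smt (verit) divide_pos_pos of_nat_less_iff)+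
    then have "2 < \<gamma> * real n" using \<gamma>0 by (simp add: field_simps)
    then show ?case using tn[of n] \<open>k < n\<close> by simp
  qed
  show ?thesis
  proof (intro exI[of _ \<gamma>] conjI \<gamma>0 whpI)
    show "(\<lambda>n. K / real n) \<longlonglongrightarrow> 0" by real_asymp
    show "\<forall>\<^sub>F n in sequentially. measure_pmf.prob (k_out_graph n (r + 1))
      {G. \<not> (\<forall>c. edge_coloring r G c \<longrightarrow> (\<exists>vs es. mono_cycle r G c vs es \<and> \<gamma> * real n \<le> real (length es)))} \<le> K / real n"
      using ev
    proof eventually_elim
      case (elim n)
      let ?G = "\<lambda>N. forget_orientation \<lparr>pverts = {1..n}, parcs = Sigma {1..n} N\<rparr>"
      have "measure_pmf.prob (k_out_graph n (r + 1))
        {G. \<not> (\<forall>c. edge_coloring r G c \<longrightarrow> (\<exists>vs es. mono_cycle r G c vs es \<and> \<gamma> * real n \<le> real (length es)))}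
        = measure_pmf.prob (out_sets n k)
        {N. \<not> (\<forall>c. edge_coloring r (?G N) c \<longrightarrow> (\<exists>vs es. mono_cycle r (?G N) c vs es \<and> \<gamma> * real n \<le> real (length es)))}"
        unfolding k_out_graph_eq k_def by (simp add: vimage_def)
      also have "\<dots> \<le> measure_pmf.prob (out_sets n k) {N. \<not> locally_sparse r n (m n) (Sigma {1..n} N)}"
      proof (rule prob_mono_support, rule ccontr)
        fix N assume N: "N \<in> set_pmf (out_sets n k)"
          and bad: "\<not> (\<forall>c. edge_coloring r (?G N) c \<longrightarrow> (\<exists>vs es. mono_cycle r (?G N) c vs es \<and> \<gamma> * real n \<le> real (length es)))"
          and "\<not> \<not> locally_sparse r n (m n) (Sigma {1..n} N)"
        then have sp: "locally_sparse r n (m n) (Sigma {1..n} N)" by simp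
        from bad obtain c where c: "edge_coloring r (?G N) c"
          "\<And>vs es. mono_cycle r (?G N) c vs es \<Longrightarrow> \<not> \<gamma> * real n \<le> real (length es)" by blast
        have Nk: "N u \<subseteq> {1..n} - {u}" "card (N u) = k" if "u \<in> {1..n}" for u
          using out_sets_support(1)[OF N _ that] elim by auto
        have "\<exists>vs es. mono_cycle r (?G N) c vs es \<and> t n < length es"
        proof (rule exists_mono_cycle[OF r _ _ _ _ _ _ c(1)])
          show "Sigma {1..n} N \<subseteq> {1..n} \<times> {1..n}" using Nk by blast
          show "fst a \<noteq> snd a" if "a \<in> Sigma {1..n} N" for a using Nk that by force
          have "card (Sigma {1..n} N) = (\<Sum>u\<in>{1..n}. card (N u))"
            by (intro card_SigmaI ballI finite_subset[OF Nk(1)]) auto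
          then show "card (Sigma {1..n} N) = (r + 1) * n" using Nk(2) by (simp add: k_def)
          fix S :: "nat set" assume S: "S \<subseteq> {1..n}" "S \<noteq> {}" "card S \<le> (4 * r + 3) * t n"
          have "(4 * r + 3) * t n \<le> m n" unfolding t_def by simp
          then show "2 * r * card (arcs_in (Sigma {1..n} N) S) \<le> (2 * r + 1) * card S"
            using sp S unfolding locally_sparse_def by auto
        qed (use elim in auto)
        then obtain vs es where "mono_cycle r (?G N) c vs es" "t n < length es" by blast
        then show False using c(2) tn[of n] by fastforce
      qed
      also have "\<dots> \<le> K / real n"
        unfolding K_def C_def using r elim mn[of n]
        by (intro prob_not_locally_sparse_le) (auto simp: k_def C_def)
      finally show ?case .
    qed
  qed
qed

section \<open>Cutting a functional digraph into blocks\<close>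

text \<open>\<open>X\<close> holds the tails whose arc is cut: a single vertex, to open a cycle, or
  all vertices whose arc stays inside its block, to leave the crossing arcs.\<close>

definition arcs_within :: "('a \<Rightarrow> 'a) \<Rightarrow> 'a set \<Rightarrow> 'a set \<Rightarrow> ('a \<times> 'a) set" where
  "arcs_within f V X = {(x, y). y = f x \<and> x \<in> V - X \<and> y \<in> V}"

definition descendants :: "('a \<Rightarrow> 'a) \<Rightarrow> 'a set \<Rightarrow> 'a set \<Rightarrow> 'a \<Rightarrow> 'a set" where
  "descendants f V X u = {x. (x, u) \<in> (arcs_within f V X)\<^sup>*}"

lemma descendants_self: "u \<in> descendants f V X u"
  by (simp add: descendants_def)

lemma descendants_subset: "u \<in> V \<Longrightarrow> descendants f V X u \<subseteq> V"
proof
  fix x assume "u \<in> V" "x \<in> descendants f V X u"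
  then have "(x, u) \<in> (arcs_within f V X)\<^sup>*" by (simp add: descendants_def)
  then show "x \<in> V" using \<open>u \<in> V\<close>
    by (induction rule: converse_rtrancl_induct) (auto simp: arcs_within_def)
qed

lemma descendants_step:
  "x \<in> V - X \<Longrightarrow> f x \<in> V \<Longrightarrow> f x \<in> descendants f V X u \<Longrightarrow> x \<in> descendants f V X u"
  unfolding descendants_def by (auto simp: arcs_within_def intro: converse_rtrancl_into_rtrancl)

lemma descendants_cases:
  assumes "x \<in> descendants f V X u" "x \<noteq> u"
  shows "x \<in> V - X" "f x \<in> V" "f x \<in> descendants f V X u"
proof -
  have "(x, u) \<in> (arcs_within f V X)\<^sup>*" using assms(1) by (simp add: descendants_def)
  then obtain y where "(x, y) \<in> arcs_within f V X" "(y, u) \<in> (arcs_within f V X)\<^sup>*"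
    using assms(2) by (meson converse_rtranclE)
  then show "x \<in> V - X" "f x \<in> V" "f x \<in> descendants f V X u"
    by (auto simp: arcs_within_def descendants_def)
qed

lemma descendants_trans:
  "x \<in> descendants f V X y \<Longrightarrow> y \<in> descendants f V X z \<Longrightarrow> x \<in> descendants f V X z"
  unfolding descendants_def by (auto intro: rtrancl_trans)

text \<open>A path into \<open>u\<close> may stop at its first visit to \<open>u\<close>, so it does
  not use the arc out of \<open>u\<close>.\<close>

lemma descendants_cut_root: "descendants f V {} u = descendants f V {u} u"
proof
  show "descendants f V {u} u \<subseteq> descendants f V {} u"
    unfolding descendants_def by (auto simp: arcs_within_def elim: rtrancl_mono[THEN subsetD, rotated])
  show "descendants f V {} u \<subseteq> descendants f V {u} u"
  proof
    fix x assume "x \<in> descendants f V {} u"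
    then have "(x, u) \<in> (arcs_within f V {})\<^sup>*" by (simp add: descendants_def)
    then show "x \<in> descendants f V {u} u"
    proof (induction rule: converse_rtrancl_induct)
      case base
      then show ?case by (rule descendants_self)
    next
      case (step y z)
      then show ?case
        by (cases "y = u") (auto simp: descendants_self arcs_within_def intro!: descendants_step)
    qed
  qed
qed

text \<open>A cycle through \<open>x\<close> also passes through the only out-neighbour of
  \<open>x\<close>; following the path to \<open>u\<close>, it would contain \<open>u\<close>, which
  has no outgoing arc left.\<close>

lemma root_tree_acyclic:
  assumes "(x, u) \<in> (arcs_within f V {u})\<^sup>*"
  shows "(x, x) \<notin> (arcs_within f V {u})\<^sup>+"
  using assms
proof (induction rule: converse_rtrancl_induct)
  case base
  show ?case
  proof
    assume "(u, u) \<in> (arcs_within f V {u})\<^sup>+"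
    then obtain y where "(u, y) \<in> arcs_within f V {u}" by (meson tranclD)
    then show False by (simp add: arcs_within_def)
  qed
next
  case (step x y)
  show ?case
  proof
    assume "(x, x) \<in> (arcs_within f V {u})\<^sup>+"
    then obtain z where z: "(x, z) \<in> arcs_within f V {u}" "(z, x) \<in> (arcs_within f V {u})\<^sup>*"
      by (meson tranclD)
    then have "z = y" using step(1) by (simp add: arcs_within_def)
    then have "(y, y) \<in> (arcs_within f V {u})\<^sup>+" using z step(1) by (meson rtrancl_into_trancl1)
    then show False using step by blast
  qed
qed

lemma exists_min_card:
  assumes "P x"
  shows "\<exists>y. P y \<and> (\<forall>z. P z \<longrightarrow> g y \<le> (g z :: nat))"
  using ex_has_least_nat[of P x g] assms by blast

text \<open>If some vertex \<open>u\<close> has many descendants, deleting the arc out of \<open>u\<close> makes them a tree,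
  in which a minimal large subtree is cut off by one more arc.\<close>

lemma exists_block:
  fixes f :: "'a \<Rightarrow> 'a" and s D :: nat
  assumes fin: "finite V" and s: "1 \<le> s" "s \<le> card V"
    and deg: "\<And>v. v \<in> V \<Longrightarrow> card {x\<in>V. f x = v} \<le> D"
  shows "\<exists>B\<subseteq>V. s \<le> card B \<and> card B \<le> (D + 2) * s \<and>
    card {x\<in>V. f x \<in> V \<and> (x \<in> B) \<noteq> (f x \<in> B)} \<le> 2"
proof (cases "\<exists>u\<in>V. s \<le> card (descendants f V {} u)")
  case True
  then obtain u where u: "u \<in> V" "s \<le> card (descendants f V {u} u)"
    using descendants_cut_root by metis
  let ?d = "descendants f V {u}"
  from exists_min_card[of "\<lambda>v. v \<in> ?d u \<and> s \<le> card (?d v)" u "\<lambda>v. card (?d v)"]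
  obtain v where v: "v \<in> ?d u" "s \<le> card (?d v)"
    and min: "\<And>w. w \<in> ?d u \<Longrightarrow> s \<le> card (?d w) \<Longrightarrow> card (?d v) \<le> card (?d w)"
    using u descendants_self by metis
  have vV: "v \<in> V" using v descendants_subset[OF u(1)] by blast
  have BV: "?d v \<subseteq> V" by (rule descendants_subset[OF vV])
  then have fB: "finite (?d v)" using fin finite_subset by blast
  let ?Ch = "{c\<in>V. f c = v \<and> c \<noteq> u}"
  \<comment> \<open>A child with \<open>s\<close> or more descendants would, by minimality, have as
    many as \<open>v\<close>; then both sets coincide and \<open>v\<close> lies on a cycle, which
    the cut at \<open>u\<close> excludes.\<close>
  have child: "card (?d c) \<le> s" if c: "c \<in> ?Ch" for c
  proof (rule ccontr)
    assume "\<not> ?thesis"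
    then have big: "s \<le> card (?d c)" by simp
    have cv: "(c, v) \<in> arcs_within f V {u}" using c vV by (auto simp: arcs_within_def)
    then have cB: "c \<in> ?d v" by (auto simp: descendants_def)
    then have "c \<in> ?d u" using v(1) descendants_trans by metis
    then have "card (?d v) \<le> card (?d c)" using big min by blast
    moreover have "?d c \<subseteq> ?d v" using cB descendants_trans by (metis subsetI)
    ultimately have "?d c = ?d v" using fB by (simp add: card_seteq)
    then have "v \<in> ?d c" using descendants_self by metis
    then have "(v, v) \<in> (arcs_within f V {u})\<^sup>+"
      using cv by (simp add: descendants_def rtrancl_into_trancl1)
    then show False using root_tree_acyclic[of v u f V] v(1) by (simp add: descendants_def)
  qed
  have "?d v \<subseteq> insert v (\<Union>c\<in>?Ch. ?d c)"
  proof
    fix x assume "x \<in> ?d v"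
    then have "(x, v) \<in> (arcs_within f V {u})\<^sup>*" by (simp add: descendants_def)
    then show "x \<in> insert v (\<Union>c\<in>?Ch. ?d c)"
    proof (cases rule: rtranclE)
      case base
      then show ?thesis by simp
    next
      case (step c)
      then have "c \<in> ?Ch" "x \<in> ?d c" by (auto simp: arcs_within_def descendants_def)
      then show ?thesis by blast
    qed
  qed
  moreover have fU: "finite (\<Union>c\<in>?Ch. ?d c)"
    using fin descendants_subset[of _ V f "{u}"] by (intro finite_UN_I) (auto intro: finite_subset)
  ultimately have "card (?d v) \<le> card (insert v (\<Union>c\<in>?Ch. ?d c))" by (intro card_mono) auto
  also have "\<dots> \<le> Suc (card (\<Union>c\<in>?Ch. ?d c))" using fU by (simp add: card_insert_if)
  also have "card (\<Union>c\<in>?Ch. ?d c) \<le> (\<Sum>c\<in>?Ch. card (?d c))"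
    using fin by (intro card_UN_le) auto
  also have "\<dots> \<le> (\<Sum>c\<in>?Ch. s)" using child by (intro sum_mono) auto
  also have "\<dots> = card ?Ch * s" by simp
  also have "card ?Ch * s \<le> D * s"
  proof (rule mult_le_mono1)
    have "card ?Ch \<le> card {x\<in>V. f x = v}" using fin by (intro card_mono) auto
    then show "card ?Ch \<le> D" using deg[OF vV] by linarith
  qed
  finally have up: "card (?d v) \<le> (D + 2) * s" using s by simp
  \<comment> \<open>Only two arcs can cross the boundary: the arc out of \<open>v\<close>, which
    leaves the subtree, and the deleted arc out of \<open>u\<close>, which may enter it.\<close>
  have "{x\<in>V. f x \<in> V \<and> (x \<in> ?d v) \<noteq> (f x \<in> ?d v)} \<subseteq> {u, v}"
    using descendants_cases[of _ f V "{u}" v] descendants_step[of _ V "{u}" f v] by blast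
  then have "card {x\<in>V. f x \<in> V \<and> (x \<in> ?d v) \<noteq> (f x \<in> ?d v)} \<le> card {u, v}"
    by (intro card_mono) auto
  also have "\<dots> \<le> 2" by (simp add: card_insert_if)
  finally show ?thesis using v(2) up BV by blast
next
  case False
  let ?d = "descendants f V {}"
  have small: "card (?d u) < s" if "u \<in> V" for u using False that by (meson not_le)
  \<comment> \<open>Closed sets are unions of components of the underlying graph on
    \<open>V\<close>, so no arc within \<open>V\<close> crosses their boundary. A smallest closed
    set with at least \<open>s\<close> vertices falls below \<open>s\<close> when one component is
    removed, and here each component is itself smaller than \<open>s\<close>.\<close>
  define closed where "closed C \<longleftrightarrow> C \<subseteq> V \<and> (\<forall>x\<in>V. f x \<in> V \<longrightarrow> (x \<in> C \<longleftrightarrow> f x \<in> C))" for C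
  from exists_min_card[of "\<lambda>C. closed C \<and> s \<le> card C" V card]
  obtain C where C: "closed C" "s \<le> card C" and min: "\<And>C'. closed C' \<Longrightarrow> s \<le> card C' \<Longrightarrow> card C \<le> card C'"
    using s by (auto simp: closed_def)
  have CV: "C \<subseteq> V" and fC: "finite C" using C fin finite_subset by (auto simp: closed_def)
  have "C \<noteq> {}" using C s by auto
  then have "Max ((\<lambda>x. card (?d x)) ` C) \<in> (\<lambda>x. card (?d x)) ` C" using fC by (intro Max_in) auto
  then obtain \<rho> where \<rho>: "\<rho> \<in> C" "card (?d \<rho>) = Max ((\<lambda>x. card (?d x)) ` C)" by auto
  have max: "card (?d x) \<le> card (?d \<rho>)" if "x \<in> C" for x
    using that fC \<rho>(2) by simp
  have \<rho>V: "\<rho> \<in> V" using \<rho> CV by blast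
  have KC: "?d \<rho> \<subseteq> C"
  proof
    fix x assume "x \<in> ?d \<rho>"
    then have "(x, \<rho>) \<in> (arcs_within f V {})\<^sup>*" by (simp add: descendants_def)
    then show "x \<in> C"
      using \<rho>(1) C(1) by (induction rule: converse_rtrancl_induct) (auto simp: arcs_within_def closed_def)
  qed
  \<comment> \<open>A vertex with the most descendants in \<open>C\<close> has no ancestors outside
    its own descendant set: passing to \<open>f \<rho>\<close> cannot enlarge the set. Hence
    \<open>?d \<rho>\<close> is a whole component.\<close>
  have f\<rho>: "f \<rho> \<in> ?d \<rho>" if "f \<rho> \<in> V"
  proof -
    have "f \<rho> \<in> C" using that \<rho>(1) \<rho>V C(1) by (auto simp: closed_def)
    have "\<rho> \<in> ?d (f \<rho>)" using that \<rho>V by (auto simp: descendants_def arcs_within_def)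
    then have "?d \<rho> \<subseteq> ?d (f \<rho>)" using descendants_trans by (metis subsetI)
    moreover have "card (?d (f \<rho>)) \<le> card (?d \<rho>)" by (rule max) fact
    moreover have "finite (?d (f \<rho>))" using descendants_subset[OF that] fin finite_subset by blast
    ultimately have "?d \<rho> = ?d (f \<rho>)" by (simp add: card_seteq)
    then show ?thesis using descendants_self by metis
  qed
  have "closed (C - ?d \<rho>)"
    unfolding closed_def
  proof (intro conjI ballI impI)
    show "C - ?d \<rho> \<subseteq> V" using CV by blast
    fix x assume x: "x \<in> V" "f x \<in> V"
    have "x \<in> C \<longleftrightarrow> f x \<in> C" using x C(1) by (simp add: closed_def)
    moreover have "x \<in> ?d \<rho> \<longleftrightarrow> f x \<in> ?d \<rho>"
      using descendants_cases[of x f V "{}" \<rho>] descendants_step[of x V "{}" f \<rho>] f\<rho> x by blast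
    ultimately show "x \<in> C - ?d \<rho> \<longleftrightarrow> f x \<in> C - ?d \<rho>" by blast
  qed
  moreover have "card (C - ?d \<rho>) < card C"
    using \<rho>(1) descendants_self[of \<rho> f V "{}"] fC by (intro psubset_card_mono) auto
  ultimately have "card (C - ?d \<rho>) < s" using min by (meson not_le)
  moreover have "card C = card (C - ?d \<rho>) + card (?d \<rho>)"
    using KC fC by (metis card_Diff_subset card_mono finite_subset le_add_diff_inverse2)
  ultimately have "card C \<le> (D + 2) * s" using small[OF \<rho>V] by simp
  moreover have "{x\<in>V. f x \<in> V \<and> (x \<in> C) \<noteq> (f x \<in> C)} = {}" using C(1) by (auto simp: closed_def)
  then have "card {x\<in>V. f x \<in> V \<and> (x \<in> C) \<noteq> (f x \<in> C)} \<le> 2" by (simp only: card.empty)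
  ultimately show ?thesis using C(2) CV by blast
qed

text \<open>Blocks are split off until at most \<open>(D + 3) * s\<close> vertices remain, which
  form the last block. As a block has at most \<open>(D + 2) * s\<close> vertices, the remainder
  never falls below \<open>s\<close>. Each block split off has at least \<open>s\<close> vertices to
  pay for its two crossing arcs. \<open>f\<close> may lead out of \<open>V\<close>, as it does for
  the remainders.\<close>

lemma exists_block_labelling:
  fixes f :: "'a \<Rightarrow> 'a" and s D :: nat
  assumes "finite V" and "1 \<le> s" "s \<le> card V"
    and "\<And>v. v \<in> V \<Longrightarrow> card {x\<in>V. f x = v} \<le> D"
  shows "\<exists>blk :: 'a \<Rightarrow> nat.
    (\<forall>x\<in>V. s \<le> card {y\<in>V. blk y = blk x} \<and> card {y\<in>V. blk y = blk x} \<le> (D + 3) * s) \<and>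
    s * card {x\<in>V. f x \<in> V \<and> blk x \<noteq> blk (f x)} \<le> 2 * card V"
  using assms
proof (induction "card V" arbitrary: V rule: less_induct)
  case less
  note fin = \<open>finite V\<close> and s = \<open>1 \<le> s\<close> and sV = \<open>s \<le> card V\<close> and deg = less.prems(4)
  show ?case
  proof (cases "card V \<le> (D + 3) * s")
    case True
    then show ?thesis using sV by (intro exI[of _ "\<lambda>_. 0"]) auto
  next
    case False
    obtain B where B: "B \<subseteq> V" "s \<le> card B" "card B \<le> (D + 2) * s"
      "card {x\<in>V. f x \<in> V \<and> (x \<in> B) \<noteq> (f x \<in> B)} \<le> 2"
      using exists_block[of V s f D, OF fin s sV deg] by blast
    let ?V = "V - B"
    let ?X = "{x\<in>V. f x \<in> V \<and> (x \<in> B) \<noteq> (f x \<in> B)}"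
    have cV: "card V = card B + card ?V"
      using B(1) fin by (metis card_Diff_subset card_mono finite_subset le_add_diff_inverse)
    have "\<exists>blk :: 'a \<Rightarrow> nat.
      (\<forall>x\<in>?V. s \<le> card {y\<in>?V. blk y = blk x} \<and> card {y\<in>?V. blk y = blk x} \<le> (D + 3) * s) \<and>
      s * card {x\<in>?V. f x \<in> ?V \<and> blk x \<noteq> blk (f x)} \<le> 2 * card ?V"
    proof (rule less.hyps)
      show "card ?V < card V" using cV B(2) s by linarith
      show "s \<le> card ?V" using cV B(3) False by (simp add: algebra_simps)
      fix v assume v: "v \<in> ?V"
      have "card {x\<in>?V. f x = v} \<le> card {x\<in>V. f x = v}" using fin by (intro card_mono) auto
      also have "\<dots> \<le> D" using v by (intro deg) auto
      finally show "card {x\<in>?V. f x = v} \<le> D" .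
    qed (use fin s in auto)
    then obtain b :: "'a \<Rightarrow> nat" where b: "\<And>x. x \<in> ?V \<Longrightarrow> s \<le> card {y\<in>?V. b y = b x} \<and> card {y\<in>?V. b y = b x} \<le> (D + 3) * s"
      and bc: "s * card {x\<in>?V. f x \<in> ?V \<and> b x \<noteq> b (f x)} \<le> 2 * card ?V" by (elim exE conjE) (rule that, auto)
    define blk where "blk x = (if x \<in> B then 0 else Suc (b x))" for x
    have "{y\<in>V. blk y = blk x} = B" if "x \<in> B" for x
      using that B(1) by (auto simp: blk_def)
    moreover have "{y\<in>V. blk y = blk x} = {y\<in>?V. b y = b x}" if "x \<in> ?V" for x
      using that by (auto simp: blk_def)
    moreover have "card B \<le> (D + 3) * s" using B(3) by (simp add: algebra_simps)
    ultimately have "s \<le> card {y\<in>V. blk y = blk x} \<and> card {y\<in>V. blk y = blk x} \<le> (D + 3) * s"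
      if "x \<in> V" for x
      using that b[of x] B(2) by (cases "x \<in> B") simp_all
    moreover have "s * card {x\<in>V. f x \<in> V \<and> blk x \<noteq> blk (f x)} \<le> 2 * card V"
    proof -
      have "{x\<in>V. f x \<in> V \<and> blk x \<noteq> blk (f x)} \<subseteq> {x\<in>?V. f x \<in> ?V \<and> b x \<noteq> b (f x)} \<union> ?X"
        by (auto simp: blk_def)
      then have "card {x\<in>V. f x \<in> V \<and> blk x \<noteq> blk (f x)} \<le> card ({x\<in>?V. f x \<in> ?V \<and> b x \<noteq> b (f x)} \<union> ?X)"
        using fin by (intro card_mono) auto
      also have "\<dots> \<le> card {x\<in>?V. f x \<in> ?V \<and> b x \<noteq> b (f x)} + card ?X" by (rule card_Un_le)
      also have "\<dots> \<le> card {x\<in>?V. f x \<in> ?V \<and> b x \<noteq> b (f x)} + 2" using B(4) by simp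
      finally have "s * card {x\<in>V. f x \<in> V \<and> blk x \<noteq> blk (f x)} \<le> s * (card {x\<in>?V. f x \<in> ?V \<and> b x \<noteq> b (f x)} + 2)"
        by (rule mult_le_mono2)
      also have "\<dots> \<le> 2 * card ?V + 2 * s" using bc by (simp add: algebra_simps)
      finally show ?thesis using cV B(2) by linarith
    qed
    ultimately show ?thesis by (intro exI[of _ blk] conjI ballI) auto
  qed
qed

section \<open>A colouring with small monochromatic components\<close>

text \<open>After its last arc from \<open>X\<close>, a walk continues from a point of
  \<open>P\<close> with arcs of \<open>S\<close> only. So adding arcs whose heads lie in a small set
  merges few components.\<close>

lemma rtrancl_Un_Image_subset:
  assumes "X \<subseteq> UNIV \<times> P"
  shows "(S \<union> X)\<^sup>* `` {x} \<subseteq> (\<Union>p\<in>insert x P. S\<^sup>* `` {p})"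
proof
  fix y assume "y \<in> (S \<union> X)\<^sup>* `` {x}"
  then have "(x, y) \<in> (S \<union> X)\<^sup>*" by simp
  then show "y \<in> (\<Union>p\<in>insert x P. S\<^sup>* `` {p})"
  proof (induction rule: rtrancl_induct)
    case base
    then show ?case by auto
  next
    case (step y z)
    show ?case
    proof (cases "(y, z) \<in> S")
      case True
      then show ?thesis using step.IH by (auto intro: rtrancl_into_rtrancl)
    next
      case False
      then have "z \<in> P" using step.hyps assms by auto
      then show ?thesis by auto
    qed
  qed
qed

lemma component_verts_subset:
  assumes "C \<in> component_verts H"
  shows "\<exists>x\<in>mverts H. C \<subseteq> {(x, y). \<exists>e\<in>medges H. mends H e = {x, y}}\<^sup>* `` {x}"
  using assms unfolding component_verts_def quotient_def connectivity_def by blast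

text \<open>Colour 1 takes the arcs inside the blocks, and the crossing arcs of index \<open>j\<close> take colour
  \<open>j + 1\<close>, except that those of index 0 join those of index 1 in colour 2.\<close>

lemma small_component_coloring:
  fixes \<omega> :: "nat \<Rightarrow> nat list" and blk :: "nat \<Rightarrow> nat" and r n L K m :: nat
  defines "V \<equiv> {1..n}"
  defines "G \<equiv> forget_orientation \<lparr>pverts = V, parcs = Sigma V (\<lambda>u. set (\<omega> u))\<rparr>"
  assumes r: "2 \<le> r"
    and \<omega>: "\<And>u. u \<in> V \<Longrightarrow> length (\<omega> u) = r \<and> set (\<omega> u) \<subseteq> V"
    and blocks: "\<And>x. x \<in> V \<Longrightarrow> card {y\<in>V. blk y = blk x} \<le> L"
    and cross: "card {x\<in>V. blk x \<noteq> blk (\<omega> x ! 0)} \<le> m"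
    and comps: "\<And>j x. 1 \<le> j \<Longrightarrow> j < r \<Longrightarrow> x \<in> V \<Longrightarrow>
      card ((arcs_within (\<lambda>u. \<omega> u ! j) V {x. blk x = blk (\<omega> x ! j)} \<union>
        (arcs_within (\<lambda>u. \<omega> u ! j) V {x. blk x = blk (\<omega> x ! j)})\<inverse>)\<^sup>* `` {x}) \<le> K"
  shows "\<exists>c. edge_coloring r G c \<and> (\<forall>C\<in>mono_component_verts r G c. card C \<le> max L (K * (1 + 2 * m)))"
proof -
  define idx where "idx e = (LEAST j. j < r \<and> \<omega> (fst e) ! j = snd e)" for e :: "nat \<times> nat"
  define c where "c e = (if blk (fst e) = blk (snd e) then 1 else max 2 (idx e + 1))" for e
  let ?A = "Sigma V (\<lambda>u. set (\<omega> u))"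
  have fV: "finite V" by (simp add: V_def)
  have idx: "idx e < r \<and> \<omega> (fst e) ! idx e = snd e" if "e \<in> ?A" for e
  proof -
    have "\<exists>j. j < r \<and> \<omega> (fst e) ! j = snd e"
      using that \<omega> by (auto simp: in_set_conv_nth)
    then show ?thesis unfolding idx_def by (rule LeastI_ex)
  qed
  have G: "mverts G = V" "medges G = ?A" "mends G = (\<lambda>(u, v). {u, v})"
    by (simp_all add: G_def forget_orientation_def)
  have "edge_coloring r G c"
    using idx r by (auto simp: edge_coloring_def G c_def Suc_le_eq)
  moreover have "card C \<le> max L (K * (1 + 2 * m))" if "C \<in> mono_component_verts r G c" for C
  proof -
    from that obtain i where i: "i \<in> {1..r}" "C \<in> component_verts (color_subgraph G c i)"
      unfolding mono_component_verts_def by blast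
    define H where "H = color_subgraph G c i"
    define E where "E = {(x, y). \<exists>e\<in>medges H. mends H e = {x, y}}"
    have H: "medges H = {e \<in> ?A. c e = i}" "mends H = (\<lambda>(u, v). {u, v})"
      "mverts H = \<Union> ((\<lambda>(u, v). {u, v}) ` {e \<in> ?A. c e = i})"
      by (simp_all add: H_def color_subgraph_def Let_def G)
    have "mverts H \<subseteq> V" using \<omega> unfolding H by auto
    then obtain x where x: "x \<in> V" "C \<subseteq> E\<^sup>* `` {x}"
      using component_verts_subset[of C H] i(2) unfolding H_def[symmetric] E_def by blast
    have E: "(u, v) \<in> E \<longleftrightarrow> (u, v) \<in> ?A \<and> c (u, v) = i \<or> (v, u) \<in> ?A \<and> c (v, u) = i" for u v
      unfolding E_def H by (auto simp: doubleton_eq_iff)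
    show ?thesis
    proof (cases "i = 1")
      case True
      have "E\<^sup>* `` {x} \<subseteq> {y\<in>V. blk y = blk x}"
      proof
        fix y assume "y \<in> E\<^sup>* `` {x}"
        then have "(x, y) \<in> E\<^sup>*" by simp
        then show "y \<in> {y\<in>V. blk y = blk x}"
        proof (induction rule: rtrancl_induct)
          case base
          then show ?case using x by simp
        next
          case (step y z)
          have "blk y = blk z" using step(2) True unfolding E by (auto simp: c_def split: if_splits)
          moreover have "z \<in> V" using step(2) \<omega> unfolding E by auto
          ultimately show ?case using step by simp
        qed
      qed
      then have "card C \<le> card {y\<in>V. blk y = blk x}" using x(2) fV by (intro card_mono) auto
      then show ?thesis using blocks[OF x(1)] by simp
    next
      case False
      define R where "R = arcs_within (\<lambda>u. \<omega> u ! (i - 1)) V {x. blk x = blk (\<omega> x ! (i - 1))}"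
      \<comment> \<open>Both ends are taken because the edges are traversed in either direction.
        These arcs carry colour 2 only, but the same bound serves all colours from 2 on.\<close>
      define P where "P = (\<Union>u\<in>{x\<in>V. blk x \<noteq> blk (\<omega> x ! 0)}. {u, \<omega> u ! 0})"
      have i2: "1 \<le> i - 1" "i - 1 < r" using False i(1) by auto
      have key: "(u, v) \<in> R \<or> u \<in> P \<and> v \<in> P" if e: "(u, v) \<in> ?A" "c (u, v) = i" for u v
      proof -
        have b: "blk u \<noteq> blk v" and mx: "max 2 (idx (u, v) + 1) = i"
          using e(2) False by (auto simp: c_def split: if_splits)
        have uV: "u \<in> V" "v \<in> V" using e(1) \<omega> by auto
        have iv: "\<omega> u ! idx (u, v) = v" using idx[OF e(1)] by simp
        show ?thesis
        proof (cases "idx (u, v) = 0")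
          case True
          then show ?thesis using iv b uV unfolding P_def by auto
        next
          case False
          then have "idx (u, v) = i - 1" using mx by linarith
          then show ?thesis using iv b uV unfolding R_def arcs_within_def by auto
        qed
      qed
      have "E \<subseteq> (R \<union> R\<inverse>) \<union> (UNIV \<times> P)"
      proof
        fix e assume "e \<in> E"
        then show "e \<in> (R \<union> R\<inverse>) \<union> (UNIV \<times> P)" using key by (cases e) (auto simp: E)
      qed
      then have "E\<^sup>* `` {x} \<subseteq> ((R \<union> R\<inverse>) \<union> (UNIV \<times> P))\<^sup>* `` {x}"
        by (intro Image_mono rtrancl_mono) auto
      also have "\<dots> \<subseteq> (\<Union>p\<in>insert x P. (R \<union> R\<inverse>)\<^sup>* `` {p})"
        by (rule rtrancl_Un_Image_subset) simp
      finally have sub: "C \<subseteq> (\<Union>p\<in>insert x P. (R \<union> R\<inverse>)\<^sup>* `` {p})" using x(2) by blast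
      have PV: "P \<subseteq> V"
      proof
        fix p assume "p \<in> P"
        then obtain u where u: "u \<in> V" "p = u \<or> p = \<omega> u ! 0" unfolding P_def by auto
        have "\<omega> u ! 0 \<in> set (\<omega> u)" using \<omega>[OF u(1)] r by (intro nth_mem) simp
        then show "p \<in> V" using u \<omega>[OF u(1)] by auto
      qed
      have RV: "(R \<union> R\<inverse>)\<^sup>* `` {p} \<subseteq> V" if "p \<in> V" for p
      proof
        fix y assume "y \<in> (R \<union> R\<inverse>)\<^sup>* `` {p}"
        then have "(p, y) \<in> (R \<union> R\<inverse>)\<^sup>*" by simp
        then show "y \<in> V" using that
          by (induction rule: rtrancl_induct) (auto simp: R_def arcs_within_def)
      qed
      have PX: "insert x P \<subseteq> V" using PV x(1) by simp
      then have fP: "finite (insert x P)" using fV by (rule finite_subset)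
      have "card P \<le> (\<Sum>u\<in>{x\<in>V. blk x \<noteq> blk (\<omega> x ! 0)}. card {u, \<omega> u ! 0})"
        unfolding P_def using fV by (intro card_UN_le) auto
      also have "\<dots> \<le> (\<Sum>u\<in>{x\<in>V. blk x \<noteq> blk (\<omega> x ! 0)}. 2)"
        by (intro sum_mono) (simp add: card_insert_if)
      also have "\<dots> \<le> 2 * m" using cross by simp
      finally have cP: "card (insert x P) \<le> 1 + 2 * m" using fP by (simp add: card_insert_if)
      have "card C \<le> card (\<Union>p\<in>insert x P. (R \<union> R\<inverse>)\<^sup>* `` {p})"
        using sub fP PX RV fV by (intro card_mono finite_UN_I) (auto intro: finite_subset)
      also have "\<dots> \<le> (\<Sum>p\<in>insert x P. card ((R \<union> R\<inverse>)\<^sup>* `` {p}))"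
        using fP by (rule card_UN_le)
      also have "\<dots> \<le> (\<Sum>p\<in>insert x P. K)"
      proof (rule sum_mono)
        fix p assume "p \<in> insert x P"
        then have "p \<in> V" using PX by blast
        from comps[OF i2 this] show "card ((R \<union> R\<inverse>)\<^sup>* `` {p}) \<le> K" unfolding R_def .
      qed
      also have "\<dots> = K * card (insert x P)" by simp
      also have "\<dots> \<le> K * (1 + 2 * m)" using cP by (rule mult_le_mono2)
      finally show ?thesis by simp
    qed
  qed
  ultimately show ?thesis by blast
qed

section \<open>Coalescing paths in functional digraphs\<close>

text \<open>The path through \<open>p\<close> that ends at \<open>w\<close>. With the end kept
  apart, \<open>p\<close> is exactly the list of tails, so two paths with a common end can have
  disjoint tails, and the empty list is the path of length 0.\<close>

fun chain_arcs :: "'a list \<Rightarrow> 'a \<Rightarrow> ('a \<times> 'a) list" where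
  "chain_arcs [] w = []"
| "chain_arcs (x # p) w = (x, hd (p @ [w])) # chain_arcs p w"

lemma map_fst_chain_arcs: "map fst (chain_arcs p w) = p"
  by (induction p) auto

lemma chain_arcs_append:
  "chain_arcs (p @ x # q) w = chain_arcs p x @ chain_arcs (x # q) w"
  by (induction p) (auto simp: hd_append)

lemma rtrancl_chain_arcs:
  "(x, w) \<in> R\<^sup>* \<Longrightarrow> \<exists>p. hd (p @ [w]) = x \<and> set (chain_arcs p w) \<subseteq> R"
proof (induction rule: converse_rtrancl_induct)
  case base
  show ?case by (intro exI[of _ "[]"]) auto
next
  case (step y z)
  then obtain p where "hd (p @ [w]) = z" "set (chain_arcs p w) \<subseteq> R" by blast
  then show ?case using step(1) by (intro exI[of _ "y # p"]) auto
qed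

text \<open>Shortest possible coalescing paths are disjoint and do not repeat vertices.\<close>

lemma coalescing_paths:
  assumes "(x, w) \<in> R\<^sup>*" "(y, w) \<in> R\<^sup>*"
  shows "\<exists>p q w. distinct (p @ q) \<and> hd (p @ [w]) = x \<and> hd (q @ [w]) = y \<and>
    set (chain_arcs p w) \<subseteq> R \<and> set (chain_arcs q w) \<subseteq> R"
proof -
  let ?P = "\<lambda>(p, q, w). hd (p @ [w]) = x \<and> hd (q @ [w]) = y \<and>
    set (chain_arcs p w) \<subseteq> R \<and> set (chain_arcs q w) \<subseteq> R"
  let ?g = "\<lambda>(p, q, w). length p + length q"
  obtain p q where "hd (p @ [w]) = x" "set (chain_arcs p w) \<subseteq> R"
    "hd (q @ [w]) = y" "set (chain_arcs q w) \<subseteq> R"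
    using rtrancl_chain_arcs[OF assms(1)] rtrancl_chain_arcs[OF assms(2)] by blast
  then have "?P (p, q, w)" by simp
  from exists_min_card[of ?P "(p, q, w)" ?g, OF this]
  obtain z where z: "?P z" "\<forall>z'. ?P z' \<longrightarrow> ?g z \<le> ?g z'" by blast
  obtain p q w where zz: "z = (p, q, w)" by (cases z) auto
  have P: "?P (p, q, w)" using z(1) unfolding zz .
  have min: "length p + length q \<le> length p' + length q'" if "?P (p', q', w')" for p' q' w'
    using z(2)[rule_format, of "(p', q', w')"] that unfolding zz by simp
  \<comment> \<open>Excising the stretch between two visits to a vertex keeps both ends of the path
    and shortens it.\<close>
  have rep: "distinct l" if l: "\<And>l'. hd (l' @ [w]) = hd (l @ [w]) \<Longrightarrow> set (chain_arcs l' w) \<subseteq> R \<Longrightarrow> length l \<le> length l'"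
    "set (chain_arcs l w) \<subseteq> R" for l
  proof (rule ccontr)
    assume "\<not> distinct l"
    then obtain a l1 l2 l3 where e: "l = l1 @ [a] @ l2 @ [a] @ l3" using not_distinct_decomp by blast
    have "l = l1 @ a # (l2 @ a # l3)" using e by simp
    then have "chain_arcs l w = chain_arcs l1 a @ chain_arcs (a # (l2 @ a # l3)) w"
      using chain_arcs_append by metis
    moreover have "chain_arcs (a # (l2 @ a # l3)) w = chain_arcs (a # l2) a @ chain_arcs (a # l3) w"
      using chain_arcs_append[of "a # l2" a l3 w] by simp
    ultimately have "set (chain_arcs (l1 @ a # l3) w) \<subseteq> R"
      using l(2) by (simp add: chain_arcs_append)
    moreover have "hd ((l1 @ a # l3) @ [w]) = hd (l @ [w])" using e by (simp add: hd_append)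
    ultimately have "length l \<le> length (l1 @ a # l3)" by (intro l(1))
    then show False using e by simp
  qed
  have "distinct p"
  proof (rule rep)
    fix l' assume "hd (l' @ [w]) = hd (p @ [w])" "set (chain_arcs l' w) \<subseteq> R"
    then have "?P (l', q, w)" using P by simp
    then show "length p \<le> length l'" using min[of l' q w] by simp
  qed (use P in simp)
  moreover have "distinct q"
  proof (rule rep)
    fix l' assume "hd (l' @ [w]) = hd (q @ [w])" "set (chain_arcs l' w) \<subseteq> R"
    then have "?P (p, l', w)" using P by simp
    then show "length q \<le> length l'" using min[of p l' w] by simp
  qed (use P in simp)
  moreover have "set p \<inter> set q = {}"
  proof (rule ccontr)
    assume "\<not> ?thesis"
    then obtain a where "a \<in> set p" "a \<in> set q" by blast
    then obtain p1 p2 q1 q2 where e: "p = p1 @ a # p2" "q = q1 @ a # q2" by (meson split_list)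
    \<comment> \<open>A vertex common to both paths is an earlier meeting point.\<close>
    then have "?P (p1, q1, a)" using P by (auto simp: chain_arcs_append hd_append)
    then have "length p + length q \<le> length p1 + length q1" using min by blast
    then show False using e by simp
  qed
  ultimately show ?thesis using P by auto
qed

text \<open>A common target survives each step of an undirected walk. A backward step prolongs the
  path to it; a forward step follows the only arc out of \<open>y\<close>, hence the path to
  \<open>w\<close>, unless \<open>w\<close> is \<open>y\<close> and the target moves on to
  \<open>z\<close>.\<close>

lemma functional_connected_coalesce:
  assumes "single_valued R" "(x, y) \<in> (R \<union> R\<inverse>)\<^sup>*"
  shows "\<exists>w. (x, w) \<in> R\<^sup>* \<and> (y, w) \<in> R\<^sup>*"
  using assms(2)
proof (induction rule: rtrancl_induct)
  case base
  then show ?case by blast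
next
  case (step y z)
  then obtain w where w: "(x, w) \<in> R\<^sup>*" "(y, w) \<in> R\<^sup>*" by blast
  show ?case
  proof (cases "(y, z) \<in> R")
    case True
    from w(2) show ?thesis
    proof (cases rule: converse_rtranclE)
      case base
      then show ?thesis using w True by (meson rtrancl.rtrancl_into_rtrancl rtrancl.rtrancl_refl)
    next
      case (step z')
      then have "z' = z" using True assms(1) by (meson single_valuedD)
      then show ?thesis using step w by blast
    qed
  next
    case False
    then have "(z, y) \<in> R" using step.hyps by simp
    then show ?thesis using w by (meson converse_rtrancl_into_rtrancl)
  qed
qed

section \<open>Ordered out-neighbours\<close>

definition distinct_lists :: "'a set \<Rightarrow> nat \<Rightarrow> 'a list set" where
  "distinct_lists A k = {l. length l = k \<and> distinct l \<and> set l \<subseteq> A}"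

lemma finite_distinct_lists: "finite A \<Longrightarrow> finite (distinct_lists A k)"
  unfolding distinct_lists_def by (rule finite_subset[OF _ finite_lists_length_eq[of A k]]) auto

lemma card_distinct_lists_Suc:
  assumes "finite A" "a \<in> A" "Suc k \<le> card A"
  shows "card (distinct_lists A (Suc k)) = card A * card (distinct_lists (A - {a}) k)"
proof -
  obtain N where N: "card A = Suc N" using assms(3) by (cases "card A") auto
  have c: "card (A - {a}) = N" using assms N by simp
  have "card (distinct_lists A (Suc k)) = \<Prod>{Suc N - Suc k + 1..Suc N}"
    using card_lists_distinct_length_eq[OF assms(1,3)] N by (simp add: distinct_lists_def)
  also have "{Suc N - Suc k + 1..Suc N} = insert (Suc N) {N - k + 1..N}" using assms(3) N by auto
  also have "\<Prod>(insert (Suc N) {N - k + 1..N}) = Suc N * \<Prod>{N - k + 1..N}" by simp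
  also have "\<Prod>{N - k + 1..N} = card (distinct_lists (A - {a}) k)"
    using card_lists_distinct_length_eq[of "A - {a}" k] assms(1,3) c N by (simp add: distinct_lists_def)
  finally show ?thesis using N by simp
qed

text \<open>Deleting the known entry \<open>b\<close> at position \<open>i\<close> is
  injective.\<close>

lemma card_distinct_lists_nth_le:
  assumes "finite A" "i \<le> k"
  shows "card {l \<in> distinct_lists A (Suc k). l ! i = b} \<le> card (distinct_lists (A - {b}) k)"
proof (rule card_inj_on_le[where f = "\<lambda>l. take i l @ drop (Suc i) l"])
  let ?S = "{l \<in> distinct_lists A (Suc k). l ! i = b}"
  have id: "l = take i l @ b # drop (Suc i) l" if "l \<in> ?S" for l
    using that assms(2) id_take_nth_drop[of i l] by (simp add: distinct_lists_def)
  show "inj_on (\<lambda>l. take i l @ drop (Suc i) l) ?S"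
  proof (rule inj_onI)
    fix l l' assume l: "l \<in> ?S" "l' \<in> ?S" and e: "take i l @ drop (Suc i) l = take i l' @ drop (Suc i) l'"
    have "length (take i l) = length (take i l')" using l by (simp add: distinct_lists_def)
    then have "take i l = take i l'" "drop (Suc i) l = drop (Suc i) l'" using e by auto
    then show "l = l'" using id[OF l(1)] id[OF l(2)] by metis
  qed
  show "(\<lambda>l. take i l @ drop (Suc i) l) ` ?S \<subseteq> distinct_lists (A - {b}) k"
  proof (rule image_subsetI)
    fix l assume l: "l \<in> ?S"
    let ?x = "take i l" and ?y = "drop (Suc i) l"
    have lx: "l = ?x @ b # ?y" by (rule id[OF l])
    have "distinct (?x @ b # ?y)" "set (?x @ b # ?y) \<subseteq> A"
      using l lx by (simp_all add: distinct_lists_def)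
    moreover have "length (?x @ ?y) = k" using l assms(2) by (simp add: distinct_lists_def)
    ultimately show "?x @ ?y \<in> distinct_lists (A - {b}) k"
      unfolding distinct_lists_def by auto
  qed
  show "finite (distinct_lists (A - {b}) k)" using assms(1) by (intro finite_distinct_lists) auto
qed

lemma card_distinct_lists_pos:
  "finite A \<Longrightarrow> k \<le> card A \<Longrightarrow> 0 < card (distinct_lists A k)"
  using card_lists_distinct_length_eq[of A k] by (simp add: distinct_lists_def prod_pos)

lemma prob_distinct_lists:
  assumes "finite A" "k \<le> card A"
  shows "measure_pmf.prob (pmf_of_set (distinct_lists A k)) {l. P l} =
    real (card {l \<in> distinct_lists A k. P l}) / real (card (distinct_lists A k))"
proof -
  have "distinct_lists A k \<noteq> {}" using card_distinct_lists_pos[OF assms] by fastforce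
  moreover have "distinct_lists A k \<inter> {l. P l} = {l \<in> distinct_lists A k. P l}" by blast
  ultimately show ?thesis
    using finite_distinct_lists[OF assms(1)] by (simp add: measure_pmf_of_set)
qed

lemma card_distinct_lists_nth_le':
  assumes "finite A" "i < k" "k \<le> card A"
  shows "real (card {l \<in> distinct_lists A k. l ! i = b}) \<le> 1 / real (card A) * real (card (distinct_lists A k))"
proof (cases "b \<in> A")
  case True
  obtain k' where k: "k = Suc k'" using assms(2) by (cases k) auto
  have "card {l \<in> distinct_lists A k. l ! i = b} \<le> card (distinct_lists (A - {b}) k')"
    using assms card_distinct_lists_nth_le[of A i k'] k by simp
  moreover have "real (card (distinct_lists A k)) = real (card A) * real (card (distinct_lists (A - {b}) k'))"
    using card_distinct_lists_Suc[OF assms(1) True, of k'] assms k by simp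
  moreover have "0 < card A" using assms by linarith
  ultimately show ?thesis by simp
next
  case False
  have "{l \<in> distinct_lists A k. l ! i = b} = {}"
    using False assms(2) by (force simp: distinct_lists_def)
  then show ?thesis by (metis card.empty mult_nonneg_nonneg of_nat_0 of_nat_0_le_iff zero_le_divide_1_iff)
qed

lemma prob_distinct_lists_nth_le:
  assumes "finite A" "i < k" "k \<le> card A"
  shows "measure_pmf.prob (pmf_of_set (distinct_lists A k)) {l. l ! i = b} \<le> 1 / real (card A)"
  unfolding prob_distinct_lists[OF assms(1,3)]
  using card_distinct_lists_nth_le'[OF assms, of b] card_distinct_lists_pos[OF assms(1,3)]
  by (simp add: divide_le_eq)

text \<open>Removing the first entry leaves a distinct list over \<open>A - {a}\<close>, where the
  one-entry bound applies. This joint bound takes the place of conditioning on the arcs of index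
  0.\<close>

lemma prob_distinct_lists_two_nth_le:
  assumes "finite A" "1 \<le> j" "j < k" "k \<le> card A"
  shows "measure_pmf.prob (pmf_of_set (distinct_lists A k)) {l. l ! 0 = a \<and> l ! j = b}
    \<le> 1 / real (card A) * (1 / real (card A - 1))"
proof (cases "a \<in> A")
  case True
  obtain k' where k: "k = Suc k'" using assms(3) by (cases k) auto
  obtain j' where j: "j = Suc j'" using assms(2) by (cases j) auto
  let ?S = "{l \<in> distinct_lists A k. l ! 0 = a \<and> l ! j = b}"
  let ?T = "{l \<in> distinct_lists (A - {a}) k'. l ! j' = b}"
  have "card ?S \<le> card ?T"
  proof (rule card_inj_on_le[where f = tl])
    have hd: "l = a # tl l" if "l \<in> ?S" for l
      using that k by (cases l) (auto simp: distinct_lists_def)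
    show "inj_on tl ?S"
    proof (rule inj_onI)
      fix l l' assume "l \<in> ?S" "l' \<in> ?S" "tl l = tl l'"
      then show "l = l'" using hd[of l] hd[of l'] by argo
    qed
    show "tl ` ?S \<subseteq> ?T"
    proof (rule image_subsetI)
      fix l assume l: "l \<in> ?S"
      then obtain l' where e: "l = a # l'" using hd by blast
      show "tl l \<in> ?T" using l k j unfolding e distinct_lists_def by auto
    qed
    show "finite ?T" using assms(1) finite_distinct_lists[of "A - {a}" k'] by simp
  qed
  also have "real (card ?T) \<le> 1 / real (card (A - {a})) * real (card (distinct_lists (A - {a}) k'))"
    using assms k j True by (intro card_distinct_lists_nth_le') auto
  finally have le: "real (card ?S) \<le> 1 / real (card A - 1) * real (card (distinct_lists (A - {a}) k'))"
    using True assms(1) by simp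
  have c: "real (card (distinct_lists A k)) = real (card A) * real (card (distinct_lists (A - {a}) k'))"
    using card_distinct_lists_Suc[OF assms(1) True, of k'] assms k by simp
  have "0 < card (distinct_lists (A - {a}) k')" "0 < card A"
    using card_distinct_lists_pos[OF assms(1,4)] c by (auto intro: Nat.gr0I)
  have "real (card ?S) / (real (card A) * real (card (distinct_lists (A - {a}) k'))) \<le>
    1 / real (card A - 1) * real (card (distinct_lists (A - {a}) k')) /
      (real (card A) * real (card (distinct_lists (A - {a}) k')))"
    using le by (intro divide_right_mono) auto
  also have "\<dots> = 1 / real (card A) * (1 / real (card A - 1))"
    using \<open>0 < card (distinct_lists (A - {a}) k')\<close> by simp
  finally show ?thesis unfolding prob_distinct_lists[OF assms(1,4)] c .
next
  case False
  have "{l \<in> distinct_lists A k. l ! 0 = a \<and> l ! j = b} = {}"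
  proof -
    have "l ! 0 \<in> A" if "l \<in> distinct_lists A k" for l
    proof -
      have "0 < length l" "set l \<subseteq> A" using that assms(3) by (auto simp: distinct_lists_def)
      then show ?thesis using nth_mem[of 0 l] by blast
    qed
    then show ?thesis using False by blast
  qed
  then show ?thesis unfolding prob_distinct_lists[OF assms(1,4)] by (simp del: Collect_empty_eq)
qed

text \<open>Every \<open>k\<close>-subset has the same number \<open>k!\<close> of
  orderings.\<close>

lemma map_set_distinct_lists:
  assumes "finite A" "k \<le> card A"
  shows "map_pmf set (pmf_of_set (distinct_lists A k)) = pmf_of_set {S. S \<subseteq> A \<and> card S = k}"
proof (rule pmf_eqI)
  let ?X = "{S. S \<subseteq> A \<and> card S = k}"
  have X: "finite ?X" "?X \<noteq> {}" using assms finite_k_subsets k_subsets_nonempty by auto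
  have fib: "card {l \<in> distinct_lists A k. set l = S} = fact k" if "S \<in> ?X" for S
  proof -
    have "{l \<in> distinct_lists A k. set l = S} = permutations_of_set S"
      using that by (auto simp: distinct_lists_def permutations_of_set_def distinct_card)
    moreover have "finite S" using that assms(1) finite_subset by blast
    ultimately show ?thesis using that by simp
  qed
  have "distinct_lists A k = (\<Union>S\<in>?X. {l \<in> distinct_lists A k. set l = S})"
    by (auto simp: distinct_lists_def distinct_card)
  then have "card (distinct_lists A k) = card (\<Union>S\<in>?X. {l \<in> distinct_lists A k. set l = S})" by simp
  also have "\<dots> = (\<Sum>S\<in>?X. card {l \<in> distinct_lists A k. set l = S})"
    using finite_distinct_lists[OF assms(1)] X by (intro card_UN_disjoint) auto
  also have "\<dots> = (\<Sum>S\<in>?X. fact k)" using fib by (intro sum.cong) auto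
  finally have c: "card (distinct_lists A k) = card ?X * fact k" by simp
  fix S
  have "pmf (map_pmf set (pmf_of_set (distinct_lists A k))) S =
    measure_pmf.prob (pmf_of_set (distinct_lists A k)) {l. set l = S}"
    by (simp add: pmf_map vimage_def)
  also have "\<dots> = real (card {l \<in> distinct_lists A k. set l = S}) / real (card ?X * fact k)"
    using prob_distinct_lists[OF assms] c by simp
  also have "\<dots> = pmf (pmf_of_set ?X) S"
  proof (cases "S \<in> ?X")
    case True
    have "pmf (pmf_of_set ?X) S = 1 / real (card ?X)" using X True by simp
    then show ?thesis using fib[OF True] by simp
  next
    case False
    have e: "{l \<in> distinct_lists A k. set l = S} = {}"
      using False by (auto simp: distinct_lists_def distinct_card)
    have "pmf (pmf_of_set ?X) S = 0" using X False by simp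
    then show ?thesis unfolding e by simp
  qed
  finally show "pmf (map_pmf set (pmf_of_set (distinct_lists A k))) S = pmf (pmf_of_set ?X) S" .
qed

text \<open>Ordering the out-neighbours uniformly at random splits the random digraph into \<open>k\<close> random
  functional digraphs.\<close>

definition out_lists :: "nat \<Rightarrow> nat \<Rightarrow> (nat \<Rightarrow> nat list) pmf" where
  "out_lists n k = Pi_pmf {1..n} [] (\<lambda>u. pmf_of_set (distinct_lists ({1..n} - {u}) k))"

lemma out_sets_eq_map_out_lists:
  assumes "k < n"
  shows "out_sets n k = map_pmf (\<lambda>\<omega> u. set (\<omega> u)) (out_lists n k)"
proof -
  have "out_sets n k = Pi_pmf {1..n} {} (\<lambda>u. map_pmf set (pmf_of_set (distinct_lists ({1..n} - {u}) k)))"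
    unfolding out_sets_def using assms by (intro Pi_pmf_cong) (auto simp: map_set_distinct_lists)
  also have "\<dots> = map_pmf (\<lambda>h. set \<circ> h) (out_lists n k)"
    unfolding out_lists_def by (intro Pi_pmf_map) auto
  finally show ?thesis by (simp add: o_def)
qed

lemma out_lists_support:
  assumes "\<omega> \<in> set_pmf (out_lists n k)" "k < n" "u \<in> {1..n}"
  shows "\<omega> u \<in> distinct_lists ({1..n} - {u}) k"
proof -
  have "\<omega> u \<in> set_pmf (pmf_of_set (distinct_lists ({1..n} - {u}) k))"
    using assms unfolding out_lists_def by (auto simp: set_Pi_pmf PiE_dflt_def)
  moreover have "distinct_lists ({1..n} - {u}) k \<noteq> {}"
    using card_distinct_lists_pos[of "{1..n} - {u}" k] assms by fastforce
  ultimately show ?thesis by (simp add: set_pmf_of_set finite_distinct_lists)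
qed

text \<open>\<open>g\<close> prescribes the whole functional digraph of index 0, and
  \<open>L\<close> prescribes arcs of index \<open>j\<close> with distinct tails. By independence of
  the lists, each vertex contributes one factor for \<open>g\<close>, and each tail of
  \<open>L\<close> a second one.\<close>

lemma prob_first_and_chain_le:
  fixes n k j :: nat and L :: "(nat \<times> nat) list"
  assumes k: "k < n" and j: "1 \<le> j" "j < k" and L: "distinct (map fst L)" "fst ` set L \<subseteq> {1..n}"
  shows "measure_pmf.prob (out_lists n k)
      {\<omega>. (\<forall>u\<in>{1..n}. \<omega> u ! 0 = g u) \<and> (\<forall>(a, b)\<in>set L. \<omega> a ! j = b)}
    \<le> (1 / real (n - 1)) ^ n * (1 / real (n - 2)) ^ length L"
proof -
  let ?X = "fst ` set L"
  have cX: "card ?X = length L" using L(1) by (metis distinct_card length_map set_map)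
  have "{\<omega>. (\<forall>u\<in>{1..n}. \<omega> u ! 0 = g u) \<and> (\<forall>(a, b)\<in>set L. \<omega> a ! j = b)}
    = Pi {1..n} (\<lambda>u. {l. l ! 0 = g u \<and> (\<forall>b. (u, b) \<in> set L \<longrightarrow> l ! j = b)})"
    using L(2) by (fastforce simp: Pi_iff)
  then have "measure_pmf.prob (out_lists n k)
      {\<omega>. (\<forall>u\<in>{1..n}. \<omega> u ! 0 = g u) \<and> (\<forall>(a, b)\<in>set L. \<omega> a ! j = b)}
    = (\<Prod>u\<in>{1..n}. measure_pmf.prob (pmf_of_set (distinct_lists ({1..n} - {u}) k))
        {l. l ! 0 = g u \<and> (\<forall>b. (u, b) \<in> set L \<longrightarrow> l ! j = b)})"
    unfolding out_lists_def by (simp add: measure_Pi_pmf_Pi)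
  also have "\<dots> \<le> (\<Prod>u\<in>{1..n}. 1 / real (n - 1) * (if u \<in> ?X then 1 / real (n - 2) else 1))"
  proof (intro prod_mono conjI measure_nonneg)
    fix u assume u: "u \<in> {1..n}"
    let ?A = "{1..n} - {u}"
    have c: "card ?A = n - 1" using u by simp
    let ?M = "measure_pmf.prob (pmf_of_set (distinct_lists ?A k))"
    show "?M {l. l ! 0 = g u \<and> (\<forall>b. (u, b) \<in> set L \<longrightarrow> l ! j = b)}
      \<le> 1 / real (n - 1) * (if u \<in> ?X then 1 / real (n - 2) else 1)"
    proof (cases "u \<in> ?X")
      case True
      then obtain b where b: "(u, b) \<in> set L" by auto
      have "?M {l. l ! 0 = g u \<and> (\<forall>b. (u, b) \<in> set L \<longrightarrow> l ! j = b)} \<le> ?M {l. l ! 0 = g u \<and> l ! j = b}"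
        using b by (intro measure_pmf.finite_measure_mono) auto
      also have "\<dots> \<le> 1 / real (card ?A) * (1 / real (card ?A - 1))"
        using j k c by (intro prob_distinct_lists_two_nth_le) auto
      also have "card ?A - 1 = n - 2" using c by simp
      finally show ?thesis using True unfolding c by simp
    next
      case False
      have "?M {l. l ! 0 = g u \<and> (\<forall>b. (u, b) \<in> set L \<longrightarrow> l ! j = b)} \<le> ?M {l. l ! 0 = g u}"
        by (intro measure_pmf.finite_measure_mono) auto
      also have "\<dots> \<le> 1 / real (card ?A)"
        using j k c by (intro prob_distinct_lists_nth_le) auto
      finally show ?thesis using False c by simp
    qed
  qed
  also have "\<dots> = (1 / real (n - 1)) ^ n * (\<Prod>u\<in>{1..n}. if u \<in> ?X then 1 / real (n - 2) else 1)"
    by (simp only: prod.distrib prod_constant card_atLeastAtMost diff_Suc_1)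
  also have "(\<Prod>u\<in>{1..n}. if u \<in> ?X then 1 / real (n - 2) else 1) = (\<Prod>u\<in>{1..n} \<inter> ?X. 1 / real (n - 2))"
    by (rule prod.inter_restrict[symmetric]) simp
  also have "{1..n} \<inter> ?X = ?X" using L(2) by blast
  finally show ?thesis using cX by simp
qed

section \<open>First moment bound for the crossing components\<close>

text \<open>Markov's inequality for the number of events \<open>Q i\<close> that occur.\<close>

lemma prob_count_gt_le:
  assumes "finite I" "0 < (c::real)"
  shows "measure_pmf.prob M {x. c < real (card {i\<in>I. Q i x})} \<le> (\<Sum>i\<in>I. measure_pmf.prob M {x. Q i x}) / c"
proof -
  let ?u = "\<lambda>x. \<Sum>i\<in>I. indicator {x. Q i x} x :: real"
  have u: "?u x = real (card {i\<in>I. Q i x})" for x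
  proof -
    have "?u x = (\<Sum>i\<in>I. if Q i x then 1 else 0)" by (intro sum.cong) (auto simp: indicator_def)
    also have "\<dots> = (\<Sum>i\<in>{i\<in>I. Q i x}. 1)" using assms(1) by (rule sum.inter_filter[symmetric])
    finally show ?thesis by simp
  qed
  have int: "integrable (measure_pmf M) (\<lambda>x. indicator {x. Q i x} x :: real)" for i
    by (rule measure_pmf.integrable_const_bound[where B = 1]) auto
  have "measure_pmf.prob M {x. c < real (card {i\<in>I. Q i x})} \<le> measure_pmf.prob M {x\<in>space (measure_pmf M). c \<le> ?u x}"
    unfolding u by (intro measure_pmf.finite_measure_mono) auto
  also have "\<dots> \<le> (\<integral>x. ?u x \<partial>measure_pmf M) / c"
    using assms int by (intro integral_Markov_inequality_measure[where A = "{}"] integrable_sum)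
      (auto intro!: AE_pmfI sum_nonneg)
  also have "(\<integral>x. ?u x \<partial>measure_pmf M) = (\<Sum>i\<in>I. measure_pmf.prob M {x. Q i x})"
    using int by (subst Bochner_Integration.integral_sum) auto
  finally show ?thesis .
qed

text \<open>Candidates for crossing paths, fixed by the labelling \<open>b\<close> alone and thus
  free of the randomness of index \<open>j\<close>, so that a union bound may range over
  them.\<close>

definition cross_lists :: "'a set \<Rightarrow> ('a \<Rightarrow> nat) \<Rightarrow> 'a \<Rightarrow> nat \<Rightarrow> 'a list set" where
  "cross_lists V b w a = {p. length p = a \<and> set p \<subseteq> V \<and> (\<forall>(x, y)\<in>set (chain_arcs p w). b x \<noteq> b y)}"

lemma finite_cross_lists: "finite V \<Longrightarrow> finite (cross_lists V b w a)"
  unfolding cross_lists_def by (rule finite_subset[OF _ finite_lists_length_eq[of V a]]) auto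

text \<open>Build the path backwards from \<open>w\<close>: each new vertex must avoid the block of
  its successor, which has at least \<open>s\<close> vertices.\<close>

lemma card_cross_lists_le:
  assumes fin: "finite V" and w: "w \<in> V" and b: "\<And>x. x \<in> V \<Longrightarrow> s \<le> card {y\<in>V. b y = b x}"
  shows "card (cross_lists V b w a) \<le> (card V - s) ^ a"
proof (induction a)
  case 0
  have "cross_lists V b w 0 = {[]}" by (auto simp: cross_lists_def)
  then show ?case by simp
next
  case (Suc a)
  let ?N = "\<lambda>p. {x\<in>V. b x \<noteq> b (hd (p @ [w]))}"
  let ?C = "cross_lists V b w a"
  have sub: "cross_lists V b w (Suc a) \<subseteq> (\<Union>p\<in>?C. (\<lambda>x. x # p) ` ?N p)"
  proof
    fix l assume l: "l \<in> cross_lists V b w (Suc a)"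
    then obtain x p where e: "l = x # p" by (cases l) (auto simp: cross_lists_def)
    show "l \<in> (\<Union>p\<in>?C. (\<lambda>x. x # p) ` ?N p)"
      using l unfolding e cross_lists_def by auto
  qed
  have N: "card (?N p) \<le> card V - s" if p: "p \<in> ?C" for p
  proof -
    have h: "hd (p @ [w]) \<in> V" using p w by (cases p) (auto simp: cross_lists_def)
    have "?N p = V - {y\<in>V. b y = b (hd (p @ [w]))}" by auto
    then have "card (?N p) = card V - card {y\<in>V. b y = b (hd (p @ [w]))}"
      using fin by (simp add: card_Diff_subset)
    then show ?thesis using b[OF h] by simp
  qed
  have "card (cross_lists V b w (Suc a)) \<le> card (\<Union>p\<in>?C. (\<lambda>x. x # p) ` ?N p)"
    using sub fin finite_cross_lists[OF fin] by (intro card_mono) auto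
  also have "\<dots> \<le> (\<Sum>p\<in>?C. card ((\<lambda>x. x # p) ` ?N p))"
    using finite_cross_lists[OF fin] by (rule card_UN_le)
  also have "\<dots> \<le> (\<Sum>p\<in>?C. card V - s)"
  proof (rule sum_mono)
    fix p assume "p \<in> ?C"
    have "card ((\<lambda>x. x # p) ` ?N p) \<le> card (?N p)" using fin by (intro card_image_le) auto
    then show "card ((\<lambda>x. x # p) ` ?N p) \<le> card V - s" using N[OF \<open>p \<in> ?C\<close>] by linarith
  qed
  also have "\<dots> \<le> (card V - s) ^ a * (card V - s)" using Suc by simp
  finally show ?case by (simp add: mult.commute)
qed

lemma chain_arcs_end:
  "hd (p @ [w]) \<in> V \<Longrightarrow> set (chain_arcs p w) \<subseteq> V \<times> V \<Longrightarrow> w \<in> V"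
  by (induction p) auto

lemma length_chain_arcs: "length (chain_arcs p w) = length p"
  by (induction p) auto

text \<open>A geometric series of ratio (n - s)/(n - 2), whose complement to 1 is (s - 2)/(n - 2);
  \<open>3 \<le> s\<close> keeps this positive.\<close>

lemma sum_cross_lists_le:
  fixes n s :: nat
  assumes fin: "finite V" and n: "card V = n" and s: "3 \<le> s" "s \<le> n" and w: "w \<in> V"
    and b: "\<And>x. x \<in> V \<Longrightarrow> s \<le> card {y\<in>V. b y = b x}"
  shows "(\<Sum>p\<in>(\<Union>a\<in>{..n}. cross_lists V b w a). (1 / real (n - 2)) ^ length p) \<le> real (n - 2) / real (s - 2)"
proof -
  let ?x = "real (n - s) / real (n - 2)"
  have x: "0 \<le> ?x" "?x < 1" using s by auto
  have "(\<Sum>p\<in>(\<Union>a\<in>{..n}. cross_lists V b w a). (1 / real (n - 2)) ^ length p)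
    = (\<Sum>a\<in>{..n}. \<Sum>p\<in>cross_lists V b w a. (1 / real (n - 2)) ^ length p)"
    using finite_cross_lists[OF fin] by (intro sum.UNION_disjoint) (auto simp: cross_lists_def)
  also have "\<dots> \<le> (\<Sum>a\<in>{..n}. ?x ^ a)"
  proof (rule sum_mono)
    fix a
    have "(\<Sum>p\<in>cross_lists V b w a. (1 / real (n - 2)) ^ length p)
      = (\<Sum>p\<in>cross_lists V b w a. (1 / real (n - 2)) ^ a)"
      by (intro sum.cong) (auto simp: cross_lists_def)
    also have "\<dots> = real (card (cross_lists V b w a)) * (1 / real (n - 2)) ^ a" by simp
    also have "\<dots> \<le> real ((n - s) ^ a) * (1 / real (n - 2)) ^ a"
      using card_cross_lists_le[OF fin w b, of a] n by (intro mult_right_mono of_nat_mono) auto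
    also have "\<dots> = ?x ^ a" by (simp add: power_divide)
    finally show "(\<Sum>p\<in>cross_lists V b w a. (1 / real (n - 2)) ^ length p) \<le> ?x ^ a" .
  qed
  also have "\<dots> \<le> (\<Sum>a. ?x ^ a)" using x by (intro sum_le_suminf summable_geometric) auto
  also have "\<dots> = 1 / (1 - ?x)" using x by (intro suminf_geometric) auto
  also have "1 - ?x = real (s - 2) / real (n - 2)"
    using s by (simp add: field_simps of_nat_diff)
  finally show ?thesis by simp
qed

text \<open>Restricting to \<open>{1..n}\<close> places the map in a finite space of extensional
  functions, over which the union bound can run.\<close>

definition first_map :: "nat \<Rightarrow> (nat \<Rightarrow> nat list) \<Rightarrow> nat \<Rightarrow> nat" where
  "first_map n \<omega> = restrict (\<lambda>u. \<omega> u ! 0) {1..n}"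

text \<open>\<open>blk\<close> receives nothing but the index-0 map, so fixing that map fixes the
  blocks.\<close>

definition cross_rel :: "((nat \<Rightarrow> nat) \<Rightarrow> nat \<Rightarrow> nat) \<Rightarrow> nat \<Rightarrow> nat \<Rightarrow> (nat \<Rightarrow> nat list) \<Rightarrow> (nat \<times> nat) set" where
  "cross_rel blk n j \<omega> = arcs_within (\<lambda>u. \<omega> u ! j) {1..n}
     {x. blk (first_map n \<omega>) x = blk (first_map n \<omega>) (\<omega> x ! j)}"

definition large_blocks :: "((nat \<Rightarrow> nat) \<Rightarrow> nat \<Rightarrow> nat) \<Rightarrow> nat \<Rightarrow> nat \<Rightarrow> (nat \<Rightarrow> nat) \<Rightarrow> bool" where
  "large_blocks blk n s g \<longleftrightarrow> (\<forall>x\<in>{1..n}. s \<le> card {y\<in>{1..n}. blk g y = blk g x})"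

text \<open>Two vertices joined by crossing arcs of index \<open>j\<close> yield two disjoint crossing paths with a
  common end; a path misses at least \<open>s\<close> vertices at each step, so the expected number of such
  configurations, given the arcs of index 0, is bounded by two geometric series.\<close>

lemma prob_large_component_le:
  fixes n k j s K :: nat
  assumes k: "k < n" and j: "1 \<le> j" "j < k" and s: "3 \<le> s" "s \<le> n" and K: "0 < K"
  shows "measure_pmf.prob (out_lists n k) {\<omega>. large_blocks blk n s (first_map n \<omega>) \<and>
      (\<exists>x\<in>{1..n}. K < card ((cross_rel blk n j \<omega> \<union> (cross_rel blk n j \<omega>)\<inverse>)\<^sup>* `` {x}))}
    \<le> real n * (real (n - 2) / real (s - 2))\<^sup>2 / (real K)\<^sup>2"
proof -
  let ?V = "{1..n}"
  let ?G = "{g \<in> PiE ?V (\<lambda>u. ?V - {u}). large_blocks blk n s g}"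
  define P where "P g w = (\<Union>a\<in>{..n}. cross_lists ?V (blk g) w a)" for g w
  \<comment> \<open>A configuration includes the whole index-0 map \<open>g\<close>, which
    determines the blocks and hence the admissible paths.\<close>
  define I where "I = (SIGMA g:?G. SIGMA w:?V. P g w \<times> P g w)"
  define Q where "Q = (\<lambda>(g, w, p, q) \<omega>. (\<forall>u\<in>?V. \<omega> u ! 0 = g u) \<and> distinct (p @ q) \<and>
    (\<forall>(a, b)\<in>set (chain_arcs p w @ chain_arcs q w). \<omega> a ! j = b))"
  have fV: "finite ?V" by simp
  have fE: "finite (PiE ?V (\<lambda>u. ?V - {u}))" by (intro finite_PiE) auto
  then have fG: "finite ?G" by simp
  have fP: "finite (P g w)" for g w unfolding P_def using finite_cross_lists[OF fV] by auto
  have fI: "finite I" unfolding I_def using fG fP by auto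
  define y where "y = 1 / real (n - 2)"
  define z where "z = (1 / real (n - 1)) ^ n"
  have z0: "0 \<le> z" by (simp add: z_def)
  have prob: "measure_pmf.prob (out_lists n k) {\<omega>. Q (g, w, p, q) \<omega>} \<le> z * (y ^ length p * y ^ length q)"
    if "(g, w, p, q) \<in> I" for g w p q
  proof (cases "distinct (p @ q)")
    case True
    let ?L = "chain_arcs p w @ chain_arcs q w"
    have L: "map fst ?L = p @ q" by (simp add: map_fst_chain_arcs)
    have "set p \<subseteq> ?V" "set q \<subseteq> ?V" using that by (auto simp: I_def P_def cross_lists_def)
    moreover have "fst ` set ?L = set (p @ q)" using L by (metis set_map)
    ultimately have "fst ` set ?L \<subseteq> ?V" by simp
    moreover have "distinct (map fst ?L)" using L True by simp
    ultimately have "measure_pmf.prob (out_lists n k)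
        {\<omega>. (\<forall>u\<in>?V. \<omega> u ! 0 = g u) \<and> (\<forall>(a, b)\<in>set ?L. \<omega> a ! j = b)}
      \<le> (1 / real (n - 1)) ^ n * (1 / real (n - 2)) ^ length ?L"
      by (intro prob_first_and_chain_le[OF k j])
    then show ?thesis using True by (simp add: Q_def z_def y_def length_chain_arcs power_add)
  next
    case False
    then have "{\<omega>. Q (g, w, p, q) \<omega>} = {}" by (auto simp: Q_def)
    then show ?thesis using z0 by (simp add: y_def)
  qed
  \<comment> \<open>More than \<open>K\<close> vertices in a component give more than
    \<open>K^2\<close> ordered pairs, and each pair is recovered from its configuration as the
    starting points of the two paths.\<close>
  have cover: "(real K)\<^sup>2 < real (card {i\<in>I. Q i \<omega>})"
    if \<omega>: "\<omega> \<in> set_pmf (out_lists n k)" and lb: "large_blocks blk n s (first_map n \<omega>)"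
      and x: "x \<in> ?V" "K < card ((cross_rel blk n j \<omega> \<union> (cross_rel blk n j \<omega>)\<inverse>)\<^sup>* `` {x})" for \<omega> x
  proof -
    define R where "R = cross_rel blk n j \<omega>"
    define g where "g = first_map n \<omega>"
    define C where "C = (R \<union> R\<inverse>)\<^sup>* `` {x}"
    have R: "(a, b) \<in> R \<longleftrightarrow> b = \<omega> a ! j \<and> a \<in> ?V \<and> b \<in> ?V \<and> blk g a \<noteq> blk g b" for a b
      unfolding R_def cross_rel_def arcs_within_def g_def[symmetric] by auto
    have RV: "R \<subseteq> ?V \<times> ?V" using R by auto
    have sv: "single_valued R" using R by (auto simp: single_valued_def)
    have "g \<in> PiE ?V (\<lambda>u. ?V - {u})"
    proof (rule PiE_I)
      fix u assume u: "u \<in> ?V"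
      have "\<omega> u \<in> distinct_lists (?V - {u}) k" by (rule out_lists_support[OF \<omega> k u])
      then have "0 < length (\<omega> u)" "set (\<omega> u) \<subseteq> ?V - {u}" using j by (auto simp: distinct_lists_def)
      then have "\<omega> u ! 0 \<in> ?V - {u}" using nth_mem by blast
      then show "g u \<in> ?V - {u}" using u by (simp add: g_def first_map_def)
    qed (auto simp: g_def first_map_def restrict_def)
    then have gG: "g \<in> ?G" using lb by (simp add: g_def)
    have CV: "C \<subseteq> ?V"
    proof
      fix y assume "y \<in> C"
      then have "(x, y) \<in> (R \<union> R\<inverse>)\<^sup>*" by (simp add: C_def)
      then show "y \<in> ?V" using x(1) RV by (induction rule: rtrancl_induct) blast+
    qed
    have "C \<times> C \<subseteq> (\<lambda>(g, w, p, q). (hd (p @ [w]), hd (q @ [w]))) ` {i\<in>I. Q i \<omega>}"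
    proof (rule subrelI)
      fix a b assume ab: "(a, b) \<in> C \<times> C"
      have "sym ((R \<union> R\<inverse>)\<^sup>*)" by (intro sym_rtrancl sym_Un_converse)
      then have "(a, x) \<in> (R \<union> R\<inverse>)\<^sup>*" "(x, b) \<in> (R \<union> R\<inverse>)\<^sup>*"
        using ab unfolding C_def by (auto dest: symD)
      then have "(a, b) \<in> (R \<union> R\<inverse>)\<^sup>*" by (rule rtrancl_trans)
      then obtain w0 where "(a, w0) \<in> R\<^sup>*" "(b, w0) \<in> R\<^sup>*"
        using functional_connected_coalesce[OF sv] by blast
      from coalescing_paths[OF this] obtain p q w where pq: "distinct (p @ q)" "hd (p @ [w]) = a" "hd (q @ [w]) = b"
        "set (chain_arcs p w) \<subseteq> R" "set (chain_arcs q w) \<subseteq> R" by blast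
      have w: "w \<in> ?V" using chain_arcs_end[of p w ?V] pq ab CV RV by blast
      have inP: "p \<in> P g w" if p: "set (chain_arcs p w) \<subseteq> R" "distinct p" for p
      proof -
        have "set p = fst ` set (chain_arcs p w)" by (metis map_fst_chain_arcs set_map)
        then have pV: "set p \<subseteq> ?V" using p(1) RV by auto
        then have "length p \<le> n" using p(2) card_mono[OF fV pV] by (simp add: distinct_card)
        moreover have "p \<in> cross_lists ?V (blk g) w (length p)"
          using p(1) pV R unfolding cross_lists_def by auto
        ultimately show ?thesis unfolding P_def by blast
      qed
      have "(g, w, p, q) \<in> I" using gG w inP pq unfolding I_def by auto
      moreover have "Q (g, w, p, q) \<omega>"
        unfolding Q_def using pq R by (auto simp: g_def first_map_def)
      ultimately show "(a, b) \<in> (\<lambda>(g, w, p, q). (hd (p @ [w]), hd (q @ [w]))) ` {i\<in>I. Q i \<omega>}"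
        using pq by (intro image_eqI[of _ _ "(g, w, p, q)"]) auto
    qed
    then have "card (C \<times> C) \<le> card {i\<in>I. Q i \<omega>}"
      using fI by (intro surj_card_le) auto
    then have "card C * card C \<le> card {i\<in>I. Q i \<omega>}" by (simp add: card_cartesian_product)
    moreover have "K * K < card C * card C"
      using x(2) by (intro mult_strict_mono) (auto simp: C_def R_def)
    ultimately have "real (K * K) < real (card {i\<in>I. Q i \<omega>})" by linarith
    then show ?thesis by (simp add: power2_eq_square)
  qed
  have "measure_pmf.prob (out_lists n k) {\<omega>. large_blocks blk n s (first_map n \<omega>) \<and>
      (\<exists>x\<in>?V. K < card ((cross_rel blk n j \<omega> \<union> (cross_rel blk n j \<omega>)\<inverse>)\<^sup>* `` {x}))}
    \<le> measure_pmf.prob (out_lists n k) {\<omega>. (real K)\<^sup>2 < real (card {i\<in>I. Q i \<omega>})}"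
    using cover by (intro prob_mono_support) blast
  also have "\<dots> \<le> (\<Sum>i\<in>I. measure_pmf.prob (out_lists n k) {\<omega>. Q i \<omega>}) / (real K)\<^sup>2"
    using fI K by (intro prob_count_gt_le) auto
  also have "(\<Sum>i\<in>I. measure_pmf.prob (out_lists n k) {\<omega>. Q i \<omega>})
    \<le> (\<Sum>(g, w, p, q)\<in>I. z * (y ^ length p * y ^ length q))"
    using prob by (intro sum_mono) auto
  also have "\<dots> = (\<Sum>g\<in>?G. \<Sum>w\<in>?V. \<Sum>(p, q)\<in>P g w \<times> P g w. z * (y ^ length p * y ^ length q))"
    unfolding I_def using fG fP by (subst sum.Sigma) (auto simp: sum.Sigma split_def intro!: sum.cong)
  also have "\<dots> \<le> (\<Sum>g\<in>?G. \<Sum>w\<in>?V. z * (real (n - 2) / real (s - 2))\<^sup>2)"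
  proof (intro sum_mono)
    fix g w assume g: "g \<in> ?G" and w: "w \<in> ?V"
    have "(\<Sum>(p, q)\<in>P g w \<times> P g w. z * (y ^ length p * y ^ length q))
      = z * ((\<Sum>p\<in>P g w. y ^ length p) * (\<Sum>q\<in>P g w. y ^ length q))"
    proof -
      have "(\<Sum>p\<in>P g w. y ^ length p) * (\<Sum>q\<in>P g w. y ^ length q)
        = (\<Sum>(p, q)\<in>P g w \<times> P g w. y ^ length p * y ^ length q)"
        by (simp only: sum_product sum.cartesian_product)
      then show ?thesis by (simp add: sum_distrib_left split_def)
    qed
    also have "(\<Sum>p\<in>P g w. y ^ length p) \<le> real (n - 2) / real (s - 2)"
      unfolding P_def y_def using g w s by (intro sum_cross_lists_le) (auto simp: large_blocks_def)
    then have "z * ((\<Sum>p\<in>P g w. y ^ length p) * (\<Sum>q\<in>P g w. y ^ length q))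
      \<le> z * (real (n - 2) / real (s - 2))\<^sup>2"
      unfolding power2_eq_square using z0 by (intro mult_left_mono mult_mono) (auto simp: y_def intro!: sum_nonneg)
    finally show "(\<Sum>(p, q)\<in>P g w \<times> P g w. z * (y ^ length p * y ^ length q))
      \<le> z * (real (n - 2) / real (s - 2))\<^sup>2" .
  qed
  also have "\<dots> = real (card ?G) * z * (real n * (real (n - 2) / real (s - 2))\<^sup>2)" by simp
  \<comment> \<open>There are at most \<open>(n - 1)^n\<close> loopless maps \<open>g\<close>, each
    of weight \<open>z\<close>.\<close>
  also have "\<dots> \<le> 1 * (real n * (real (n - 2) / real (s - 2))\<^sup>2)"
  proof (rule mult_right_mono)
    have "card ?G \<le> card (PiE ?V (\<lambda>u. ?V - {u}))" using fE by (intro card_mono) auto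
    also have "\<dots> = (\<Prod>u\<in>?V. card (?V - {u}))" by (rule card_PiE) simp
    also have "\<dots> = (\<Prod>u\<in>?V. n - 1)" by (intro prod.cong) auto
    also have "\<dots> = (n - 1) ^ n" by simp
    finally have "real (card ?G) \<le> real (n - 1) ^ n" by (metis of_nat_le_iff of_nat_power)
    then show "real (card ?G) * z \<le> 1" using k j by (simp add: z_def power_divide divide_le_eq)
  qed simp
  finally show ?thesis by (simp add: divide_right_mono)
qed

section \<open>Asymptotics\<close>

text \<open>Union bound over \<open>v\<close> and the \<open>d\<close>-sets of in-neighbours; the 2
  bounds n/(n - 1).\<close>

lemma prob_large_indegree_le:
  fixes n k d :: nat
  assumes k: "1 \<le> k" "k < n"
  shows "measure_pmf.prob (out_lists n k) {\<omega>. \<exists>v\<in>{1..n}. d \<le> card {u\<in>{1..n}. \<omega> u ! 0 = v}}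
    \<le> real n * 2 ^ d / fact d"
proof -
  let ?V = "{1..n}"
  let ?T = "{T. T \<subseteq> ?V \<and> card T = d}"
  let ?M = "measure_pmf.prob (out_lists n k)"
  have fT: "finite ?T" by (intro finite_k_subsets) auto
  have prob: "?M {\<omega>. \<forall>u\<in>T. \<omega> u ! 0 = v} \<le> (1 / real (n - 1)) ^ d" if T: "T \<in> ?T" for T v
  proof -
    have "{\<omega>. \<forall>u\<in>T. \<omega> u ! 0 = v} = Pi ?V (\<lambda>u. {l. u \<in> T \<longrightarrow> l ! 0 = v})"
      using T by (auto simp: Pi_iff)
    then have "?M {\<omega>. \<forall>u\<in>T. \<omega> u ! 0 = v} =
      (\<Prod>u\<in>?V. measure_pmf.prob (pmf_of_set (distinct_lists (?V - {u}) k)) {l. u \<in> T \<longrightarrow> l ! 0 = v})"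
      unfolding out_lists_def by (simp add: measure_Pi_pmf_Pi)
    also have "\<dots> \<le> (\<Prod>u\<in>?V. if u \<in> T then 1 / real (n - 1) else 1)"
    proof (intro prod_mono conjI measure_nonneg)
      fix u assume u: "u \<in> ?V"
      then have c: "card (?V - {u}) = n - 1" by simp
      show "measure_pmf.prob (pmf_of_set (distinct_lists (?V - {u}) k)) {l. u \<in> T \<longrightarrow> l ! 0 = v}
        \<le> (if u \<in> T then 1 / real (n - 1) else 1)"
      proof (cases "u \<in> T")
        case True
        then show ?thesis using prob_distinct_lists_nth_le[of "?V - {u}" 0 k v] k c by simp
      qed simp
    qed
    also have "\<dots> = (\<Prod>u\<in>?V \<inter> T. 1 / real (n - 1))" by (rule prod.inter_restrict[symmetric]) simp
    also have "?V \<inter> T = T" using T by blast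
    finally show ?thesis using T by simp
  qed
  have "{\<omega>. \<exists>v\<in>?V. d \<le> card {u\<in>?V. \<omega> u ! 0 = v}} \<subseteq> (\<Union>(v, T)\<in>?V \<times> ?T. {\<omega>. \<forall>u\<in>T. \<omega> u ! 0 = v})"
  proof
    fix \<omega> assume "\<omega> \<in> {\<omega>. \<exists>v\<in>?V. d \<le> card {u\<in>?V. \<omega> u ! 0 = v}}"
    then obtain v where v: "v \<in> ?V" "d \<le> card {u\<in>?V. \<omega> u ! 0 = v}" by blast
    obtain T where "T \<subseteq> {u\<in>?V. \<omega> u ! 0 = v}" "card T = d"
      using obtain_subset_with_card_n[OF v(2)] by blast
    then have "(v, T) \<in> ?V \<times> ?T" "\<forall>u\<in>T. \<omega> u ! 0 = v" using v(1) by auto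
    then show "\<omega> \<in> (\<Union>(v, T)\<in>?V \<times> ?T. {\<omega>. \<forall>u\<in>T. \<omega> u ! 0 = v})" by blast
  qed
  then have "?M {\<omega>. \<exists>v\<in>?V. d \<le> card {u\<in>?V. \<omega> u ! 0 = v}}
    \<le> ?M (\<Union>x\<in>?V \<times> ?T. case x of (v, T) \<Rightarrow> {\<omega>. \<forall>u\<in>T. \<omega> u ! 0 = v})"
    by (intro measure_pmf.finite_measure_mono) auto
  also have "\<dots> \<le> (\<Sum>x\<in>?V \<times> ?T. ?M (case x of (v, T) \<Rightarrow> {\<omega>. \<forall>u\<in>T. \<omega> u ! 0 = v}))"
    using fT by (intro prob_UN_le_sum) simp
  also have "\<dots> \<le> (\<Sum>x\<in>?V \<times> ?T. (1 / real (n - 1)) ^ d)"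
  proof (rule sum_mono)
    fix x assume "x \<in> ?V \<times> ?T"
    then show "?M (case x of (v, T) \<Rightarrow> {\<omega>. \<forall>u\<in>T. \<omega> u ! 0 = v}) \<le> (1 / real (n - 1)) ^ d"
      using prob by (cases x) auto
  qed
  also have "\<dots> = real n * (real (n choose d) * (1 / real (n - 1)) ^ d)"
    using n_subsets[of ?V d] by (simp add: card_cartesian_product)
  also have "\<dots> \<le> real n * (2 ^ d / fact d)"
  proof (rule mult_left_mono)
    have "real ((n choose d) * fact d) \<le> real (n ^ d)"
      using binomial_fact_pow[of n d] by (intro of_nat_mono)
    then have "real (n choose d) \<le> real n ^ d / fact d" by (simp add: pos_le_divide_eq)
    then have "real (n choose d) * (1 / real (n - 1)) ^ d \<le> real n ^ d / fact d * (1 / real (n - 1)) ^ d"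
      by (intro mult_right_mono) auto
    also have "\<dots> = (real n / real (n - 1)) ^ d / fact d" by (simp add: power_divide)
    also have "\<dots> \<le> 2 ^ d / fact d"
      using k by (intro divide_right_mono power_mono) (auto simp: field_simps of_nat_diff)
    finally show "real (n choose d) * (1 / real (n - 1)) ^ d \<le> 2 ^ d / fact d" .
  qed simp
  finally show ?thesis by simp
qed

text \<open>Since \<open>n = (n powr 0.05)^20\<close>, the factor \<open>n\<close> of the in-degree
  bound becomes the 20th power of \<open>d\<close>. The expression splits into
  \<open>d^20 / 2^d\<close> and \<open>4^d / d!\<close>, both of which vanish.\<close>

lemma large_indegree_limit: "(\<lambda>d. real d ^ 20 * 2 ^ d / fact d) \<longlonglongrightarrow> 0"
proof -
  have a: "(\<lambda>d. real d ^ 20 / 2 ^ d) \<longlonglongrightarrow> 0" by real_asymp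
  have "(\<lambda>d. inverse (fact d) * 4 ^ d :: real) \<longlonglongrightarrow> 0"
    by (intro summable_LIMSEQ_zero summable_exp)
  from tendsto_mult[OF a this]
  have l: "(\<lambda>d. real d ^ 20 / 2 ^ d * (inverse (fact d) * 4 ^ d)) \<longlonglongrightarrow> 0" by simp
  have "(4 :: real) ^ d = 2 ^ d * 2 ^ d" for d by (simp flip: power_mult_distrib)
  then have "real d ^ 20 / 2 ^ d * (inverse (fact d) * 4 ^ d) = real d ^ 20 * 2 ^ d / fact d" for d
    by (simp add: field_simps)
  then show ?thesis using l by simp
qed

section \<open>Choice of the parameters and the proof of (i)\<close>

definition block_labelling :: "nat \<Rightarrow> nat \<Rightarrow> nat \<Rightarrow> (nat \<Rightarrow> nat) \<Rightarrow> (nat \<Rightarrow> nat) \<Rightarrow> bool" where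
  "block_labelling n s D g b \<longleftrightarrow>
     (\<forall>x\<in>{1..n}. s \<le> card {y\<in>{1..n}. b y = b x} \<and> card {y\<in>{1..n}. b y = b x} \<le> (D + 3) * s) \<and>
     s * card {x\<in>{1..n}. g x \<in> {1..n} \<and> b x \<noteq> b (g x)} \<le> 2 * n"

text \<open>The deterministic half of (i). The in-degree bound yields some labelling, hence
  \<open>blk g\<close> is one too; its blocks are then large, which is the proviso under which the
  component bound is available.\<close>

lemma good_lists_coloring:
  fixes \<omega> :: "nat \<Rightarrow> nat list" and blk :: "(nat \<Rightarrow> nat) \<Rightarrow> nat \<Rightarrow> nat" and n r s D K :: nat
  assumes r: "2 \<le> r" "r < n" and s: "1 \<le> s" "s \<le> n"
    and \<omega>: "\<omega> \<in> set_pmf (out_lists n r)"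
    and blk: "\<And>g b. block_labelling n s D g b \<Longrightarrow> block_labelling n s D g (blk g)"
    and deg: "\<And>v. v \<in> {1..n} \<Longrightarrow> card {u\<in>{1..n}. \<omega> u ! 0 = v} \<le> D"
    and comps: "large_blocks blk n s (first_map n \<omega>) \<Longrightarrow> \<forall>j\<in>{1..<r}. \<forall>x\<in>{1..n}.
      card ((cross_rel blk n j \<omega> \<union> (cross_rel blk n j \<omega>)\<inverse>)\<^sup>* `` {x}) \<le> K"
  shows "\<exists>c. edge_coloring r (forget_orientation \<lparr>pverts = {1..n}, parcs = Sigma {1..n} (\<lambda>u. set (\<omega> u))\<rparr>) c \<and>
    (\<forall>C\<in>mono_component_verts r (forget_orientation \<lparr>pverts = {1..n}, parcs = Sigma {1..n} (\<lambda>u. set (\<omega> u))\<rparr>) c.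
      card C \<le> max ((D + 3) * s) (K * (1 + 2 * (2 * n div s))))"
proof -
  let ?V = "{1..n}"
  define g where "g = first_map n \<omega>"
  define b where "b = blk g"
  have gx: "g x = \<omega> x ! 0" if "x \<in> ?V" for x using that by (simp add: g_def first_map_def)
  have \<omega>V: "length (\<omega> u) = r \<and> set (\<omega> u) \<subseteq> ?V" if "u \<in> ?V" for u
    using out_lists_support[OF \<omega> r(2) that] by (auto simp: distinct_lists_def)
  have gV: "g x \<in> ?V" if "x \<in> ?V" for x
  proof -
    have "0 < length (\<omega> x)" using \<omega>V[OF that] r by simp
    then have "\<omega> x ! 0 \<in> set (\<omega> x)" by (rule nth_mem)
    then show ?thesis using \<omega>V[OF that] gx[OF that] by auto
  qed
  have "card {x\<in>?V. g x = v} \<le> D" if "v \<in> ?V" for v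
  proof -
    have "{x\<in>?V. g x = v} = {u\<in>?V. \<omega> u ! 0 = v}" using gx by auto
    then show ?thesis using deg[OF that] by simp
  qed
  then have "\<exists>b. block_labelling n s D g b"
    using exists_block_labelling[of ?V s g D] s by (simp add: block_labelling_def)
  then have "block_labelling n s D g b" using blk unfolding b_def by blast
  then have b: "\<And>x. x \<in> ?V \<Longrightarrow> s \<le> card {y\<in>?V. b y = b x}" "\<And>x. x \<in> ?V \<Longrightarrow> card {y\<in>?V. b y = b x} \<le> (D + 3) * s"
    and cr: "s * card {x\<in>?V. g x \<in> ?V \<and> b x \<noteq> b (g x)} \<le> 2 * n"
    unfolding block_labelling_def by blast+
  have "large_blocks blk n s (first_map n \<omega>)"
    unfolding large_blocks_def using b(1) by (simp add: b_def g_def)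
  note comps = comps[OF this]
  have "{x\<in>?V. b x \<noteq> b (\<omega> x ! 0)} = {x\<in>?V. g x \<in> ?V \<and> b x \<noteq> b (g x)}"
    using gx gV by (intro Collect_cong) metis
  then have "card {x\<in>?V. b x \<noteq> b (\<omega> x ! 0)} * s \<le> 2 * n" using cr by (simp add: mult.commute)
  then have cross: "card {x\<in>?V. b x \<noteq> b (\<omega> x ! 0)} \<le> 2 * n div s"
    using s by (simp add: less_eq_div_iff_mult_less_eq)
  show ?thesis
  proof (rule small_component_coloring[OF r(1) _ _ cross])
    fix j x assume "1 \<le> j" "j < r" "x \<in> ?V"
    then have "card ((cross_rel blk n j \<omega> \<union> (cross_rel blk n j \<omega>)\<inverse>)\<^sup>* `` {x}) \<le> K"
      using comps by simp
    then show "card ((arcs_within (\<lambda>u. \<omega> u ! j) ?V {x. b x = b (\<omega> x ! j)} \<union>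
        (arcs_within (\<lambda>u. \<omega> u ! j) ?V {x. b x = b (\<omega> x ! j)})\<inverse>)\<^sup>* `` {x}) \<le> K"
      unfolding cross_rel_def b_def g_def .
  qed (fact \<omega>V b(2))+
qed

lemma whp_small_components:
  fixes r :: nat
  assumes r: "2 \<le> r"
  shows "\<exists>f :: nat \<Rightarrow> real. (\<lambda>n. f n / real n) \<longlonglongrightarrow> 0 \<and>
       whp (\<lambda>n. k_out_graph n r)
         (\<lambda>n G. \<exists>c. edge_coloring r G c \<and>
            (\<forall>C\<in>mono_component_verts r G c. real (card C) \<le> f n))"
proof -
  \<comment> \<open>With \<open>s\<close> of order \<open>n^0.9\<close>, the expected number of
    connected pairs is of order n(n/s)^2 = \<open>n^1.2\<close>, below \<open>K^2\<close> of order
    \<open>n^1.4\<close>, so \<open>e\<close> has order \<open>n^(-0.2)\<close>. Blocks have order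
    at most \<open>n^0.95\<close>, and the roughly \<open>n^0.1\<close> crossing arcs of index 0
    join components of order at most \<open>n^0.7\<close> into at most \<open>n^0.8\<close>, up to
    constants.\<close>
  define s where "s n = nat \<lceil>real n powr 0.9\<rceil>" for n
  define D where "D n = nat \<lfloor>real n powr 0.05\<rfloor>" for n
  define K where "K n = nat \<lceil>real n powr 0.7\<rceil>" for n
  define f where "f n = (real n powr 0.05 + 3) * (real n powr 0.9 + 1) +
    (real n powr 0.7 + 1) * (1 + 4 * real n powr 0.1)" for n
  define h where "h d = real d ^ 20 * 2 ^ d / fact d" for d
  define e where "e n = real n * (real n / (real n powr 0.9 - 2))\<^sup>2 / (real n powr 0.7)\<^sup>2" for n
  \<comment> \<open>\<open>SOME\<close> fixes one labelling for each index-0 map, regardless of the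
    arcs of other indices.\<close>
  define blk where "blk n g = (SOME b. block_labelling n (s n) (D n) g b)" for n g
  have blk: "block_labelling n (s n) (D n) g (blk n g)" if "block_labelling n (s n) (D n) g b" for n g b
    using someI[where P = "block_labelling n (s n) (D n) g", OF that] by (simp only: blk_def)
  have s_ge: "real n powr 0.9 \<le> real (s n)" for n unfolding s_def by linarith
  have s_le: "real (s n) \<le> real n powr 0.9 + 1" for n
    unfolding s_def by (smt (verit) of_int_ceiling_le_add_one of_nat_nat powr_ge_zero ceiling_mono ceiling_zero)
  have K_ge: "real n powr 0.7 \<le> real (K n)" for n unfolding K_def by linarith
  have K_le: "real (K n) \<le> real n powr 0.7 + 1" for n
    unfolding K_def by (smt (verit) of_int_ceiling_le_add_one of_nat_nat powr_ge_zero ceiling_mono ceiling_zero)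
  have D_le: "real (D n) \<le> real n powr 0.05" for n
    unfolding D_def by (simp add: of_nat_nat)
  have D_ge: "real n powr 0.05 \<le> real (D n + 1)" for n
    unfolding D_def by linarith
  have "\<forall>\<^sub>F n in sequentially. 3 \<le> real n powr 0.9 \<and> real n powr 0.9 + 1 \<le> real n \<and> real r < real n"
    by (intro eventually_conj; real_asymp)
  then have ev: "\<forall>\<^sub>F n in sequentially. 3 \<le> s n \<and> s n \<le> n \<and> r < n \<and> 3 \<le> real n powr 0.9"
  proof eventually_elim
    case (elim n)
    then have "3 \<le> real (s n)" "real (s n) \<le> real n" using s_ge[of n] s_le[of n] by linarith+
    then show ?case using elim by simp
  qed
  have fbound: "real (max ((D n + 3) * s n) (K n * (1 + 2 * (2 * n div s n)))) \<le> f n"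
    if n: "3 \<le> s n" "3 \<le> real n powr 0.9" for n
  proof -
    have n0: "0 < real n" using n(2) by (cases "n = 0") auto
    have "real (2 * n div s n) \<le> real (2 * n) / real (s n)"  by (rule of_nat_div_le_of_nat)
    also have "\<dots> \<le> real (2 * n) / real n powr 0.9"
      using s_ge[of n] n n0 by (intro divide_left_mono) auto
    also have "\<dots> = 2 * (real n powr 1 / real n powr 0.9)" using n0 by simp
    also have "real n powr 1 / real n powr 0.9 = real n powr (1 - 0.9)" by (rule powr_diff[symmetric])
    also have "1 - 0.9 = (0.1 :: real)" by simp
    finally have "real (K n) * (1 + 2 * real (2 * n div s n)) \<le> (real n powr 0.7 + 1) * (1 + 4 * real n powr 0.1)"
      using K_le[of n] by (intro mult_mono) auto
    moreover have "real (D n + 3) * real (s n) \<le> (real n powr 0.05 + 3) * (real n powr 0.9 + 1)"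
      using D_le[of n] s_le[of n] by (intro mult_mono) auto
    moreover have "0 \<le> (real n powr 0.7 + 1) * (1 + 4 * real n powr 0.1)"
      "0 \<le> (real n powr 0.05 + 3) * (real n powr 0.9 + 1)" by simp_all
    moreover have "real ((D n + 3) * s n) = real (D n + 3) * real (s n)"
      "real (K n * (1 + 2 * (2 * n div s n))) = real (K n) * (1 + 2 * real (2 * n div s n))"
      by (simp_all only: of_nat_mult of_nat_add of_nat_1 of_nat_numeral)
    ultimately have "real ((D n + 3) * s n) \<le> f n" "real (K n * (1 + 2 * (2 * n div s n))) \<le> f n"
      unfolding f_def by linarith+
    then show ?thesis unfolding of_nat_max by (rule max.boundedI)
  qed
  show ?thesis
  proof (intro exI[of _ f] conjI whpI)
    show "(\<lambda>n. f n / real n) \<longlonglongrightarrow> 0" unfolding f_def by real_asymp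
    have "filterlim (\<lambda>n. D n + 1) at_top sequentially"
      unfolding D_def by real_asymp
    from filterlim_compose[OF large_indegree_limit this] have "(\<lambda>n. h (D n + 1)) \<longlonglongrightarrow> 0"
      by (simp only: h_def)
    moreover have "e \<longlonglongrightarrow> 0" unfolding e_def by real_asymp
    ultimately have "(\<lambda>n. h (D n + 1) + real r * e n) \<longlonglongrightarrow> 0 + real r * 0"
      by (intro tendsto_intros)
    then show "(\<lambda>n. h (D n + 1) + real r * e n) \<longlonglongrightarrow> 0" by simp
    show "\<forall>\<^sub>F n in sequentially. measure_pmf.prob (k_out_graph n r) {G. \<not> (\<exists>c. edge_coloring r G c \<and>
      (\<forall>C\<in>mono_component_verts r G c. real (card C) \<le> f n))} \<le> h (D n + 1) + real r * e n"
      using ev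
    proof eventually_elim
      case (elim n)
      let ?G = "\<lambda>\<omega>. forget_orientation \<lparr>pverts = {1..n}, parcs = Sigma {1..n} (\<lambda>u. set (\<omega> u))\<rparr>"
      let ?M = "measure_pmf.prob (out_lists n r)"
      define A where "A = {\<omega>. \<exists>v\<in>{1..n}. D n + 1 \<le> card {u\<in>{1..n}. \<omega> u ! 0 = v}}"
      define B where "B j = {\<omega>. large_blocks (blk n) n (s n) (first_map n \<omega>) \<and>
        (\<exists>x\<in>{1..n}. K n < card ((cross_rel (blk n) n j \<omega> \<union> (cross_rel (blk n) n j \<omega>)\<inverse>)\<^sup>* `` {x}))}" for j
      have rn: "r < n" and n0: "0 < n" using elim by auto
      have "measure_pmf.prob (k_out_graph n r) {G. \<not> (\<exists>c. edge_coloring r G c \<and>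
          (\<forall>C\<in>mono_component_verts r G c. real (card C) \<le> f n))}
        = ?M {\<omega>. \<not> (\<exists>c. edge_coloring r (?G \<omega>) c \<and>
          (\<forall>C\<in>mono_component_verts r (?G \<omega>) c. real (card C) \<le> f n))}"
        unfolding k_out_graph_eq out_sets_eq_map_out_lists[OF rn] by (simp add: vimage_def)
      also have "\<dots> \<le> ?M {\<omega>. \<omega> \<in> A \<union> (\<Union>j\<in>{1..<r}. B j)}"
      proof (rule prob_mono_support, rule ccontr)
        fix \<omega> assume \<omega>: "\<omega> \<in> set_pmf (out_lists n r)"
          and bad: "\<not> (\<exists>c. edge_coloring r (?G \<omega>) c \<and>
            (\<forall>C\<in>mono_component_verts r (?G \<omega>) c. real (card C) \<le> f n))"
          and good: "\<omega> \<notin> A \<union> (\<Union>j\<in>{1..<r}. B j)"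
        have "\<exists>c. edge_coloring r (?G \<omega>) c \<and> (\<forall>C\<in>mono_component_verts r (?G \<omega>) c.
          card C \<le> max ((D n + 3) * s n) (K n * (1 + 2 * (2 * n div s n))))"
        proof (rule good_lists_coloring[where blk = "blk n", OF r rn _ _ \<omega> blk])
          show "card {u\<in>{1..n}. \<omega> u ! 0 = v} \<le> D n" if "v \<in> {1..n}" for v
            using good that unfolding A_def by force
          show "\<forall>j\<in>{1..<r}. \<forall>x\<in>{1..n}.
            card ((cross_rel (blk n) n j \<omega> \<union> (cross_rel (blk n) n j \<omega>)\<inverse>)\<^sup>* `` {x}) \<le> K n"
            if "large_blocks (blk n) n (s n) (first_map n \<omega>)"
            using good that unfolding B_def by (auto simp: not_less)
        qed (use elim in auto)
        then obtain c where c: "edge_coloring r (?G \<omega>) c" "\<And>C. C \<in> mono_component_verts r (?G \<omega>) c \<Longrightarrow>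
          card C \<le> max ((D n + 3) * s n) (K n * (1 + 2 * (2 * n div s n)))" by blast
        have "real (card C) \<le> f n" if "C \<in> mono_component_verts r (?G \<omega>) c" for C
          using order_trans[OF of_nat_mono[OF c(2)[OF that]] fbound[of n]] elim by blast
        then show False using bad c(1) by blast
      qed
      also have "\<dots> \<le> ?M A + ?M (\<Union>j\<in>{1..<r}. B j)"
        unfolding Collect_mem_eq by (intro measure_Un_le) auto
      also have "?M (\<Union>j\<in>{1..<r}. B j) \<le> (\<Sum>j\<in>{1..<r}. ?M (B j))" by (intro prob_UN_le_sum) simp
      also have "\<dots> \<le> (\<Sum>j\<in>{1..<r}. e n)"
      proof (rule sum_mono)
        fix j assume j: "j \<in> {1..<r}"
        have K0: "0 < K n" using K_ge[of n] n0 by (metis gr0I not_le of_nat_0 of_nat_0_less_iff powr_gt_zero less_irrefl)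
        have "?M (B j) \<le> real n * (real (n - 2) / real (s n - 2))\<^sup>2 / (real (K n))\<^sup>2"
          unfolding B_def using j elim K0 by (intro prob_large_component_le) auto
        also have "\<dots> \<le> e n"
          unfolding e_def
        proof (intro frac_le mult_left_mono power_mono)
          show "real n powr 0.9 - 2 \<le> real (s n - 2)" using s_ge[of n] elim by (simp add: of_nat_diff)
        qed (use elim n0 K_ge in auto)
        finally show "?M (B j) \<le> e n" .
      qed
      also have "\<dots> \<le> real r * e n"
      proof -
        have "0 \<le> e n" by (simp add: e_def)
        then show ?thesis by (simp add: mult_right_mono)
      qed
      also have "?M A \<le> h (D n + 1)"
      proof -
        have "?M A \<le> real n * 2 ^ (D n + 1) / fact (D n + 1)"
          unfolding A_def using r rn by (intro prob_large_indegree_le) auto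
        also have "real n = (real n powr 0.05) ^ 20" using n0 by (simp add: powr_powr flip: powr_realpow)
        also have "(real n powr 0.05) ^ 20 * 2 ^ (D n + 1) / fact (D n + 1) \<le> h (D n + 1)"
          unfolding h_def using D_ge[of n] by (intro divide_right_mono mult_right_mono power_mono) auto
        finally show ?thesis .
      qed
      finally show ?case by simp
    qed
  qed
qed

theorem theorem1p2:
  fixes r :: nat
  assumes "r \<ge> 2"
  shows "\<exists>\<gamma>::real. \<gamma> > 0 \<and>
    (\<exists>f :: nat \<Rightarrow> real. (\<lambda>n. f n / real n) \<longlonglongrightarrow> 0 \<and>
       whp (\<lambda>n. k_out_graph n r)
         (\<lambda>n G. \<exists>c. edge_coloring r G c \<and>
            (\<forall>C\<in>mono_component_verts r G c. real (card C) \<le> f n))) \<and>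
    whp (\<lambda>n. k_out_graph n (r + 1))
      (\<lambda>n G. \<forall>c. edge_coloring r G c \<longrightarrow>
         (\<exists>vs es. mono_cycle r G c vs es \<and> real (length es) \<ge> \<gamma> * real n))"
proof -
  obtain \<gamma> :: real where \<gamma>: "\<gamma> > 0" "whp (\<lambda>n. k_out_graph n (r + 1))
      (\<lambda>n G. \<forall>c. edge_coloring r G c \<longrightarrow>
         (\<exists>vs es. mono_cycle r G c vs es \<and> real (length es) \<ge> \<gamma> * real n))"
    using whp_long_mono_cycle[of r] assms by auto
  show ?thesis by (intro exI[of _ \<gamma>] conjI \<gamma> whp_small_components assms)
qed

end
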